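(* Let $q$ be a prime power and let $d,u,r$ be positive integers with $r>2d-4\ge2$, $(r+1)\mid(q-1)$, and $r+1<q-1$. For each integer $s$ satisfying $0\le s\le d-2$, if one of the following conditions holds: 1) $d\in\{3,4\}$; 2) $d\ge5$ and $u(r+1)\le q-1$, then there exists a pure $[[u(r+1),\,ur-2d+4+s,\,d;\,u+s]]_q$ (CSS-like) EAQLRC with locality $r$ which is optimal with respect to the Singleton-like bound, i.e. with $n=u(r+1)$, $\kappa=ur-2d+4+s$, $\delta=d$, $c=u+s$ it satisfies $2\delta=n+c-\kappa-2\lceil\kappa/r\rceil+4$.
   Context: Notation. $[m]=\{1,\dots,m\}$. An $[n,k,d]_q$ linear code is a $k$-dimensional subspace of $\mathbb F_q^n$ with minimum distance $d$; $\mathcal C^\perp$ is the Euclidean dual; $\mathrm{supp}(\mathbf u)=\{i:u_i\neq0\}$; for a set $S\subseteq\mathbb F_q^n$ containing a nonzero vector, $\mathrm{wt}(S)$ is the minimum Hamming weight of its nonzero vectors. CSS-like EAQLRC with locality $r$. This is the code $\mathcal Q(\mathcal C_X,\mathcal C_Z)$ given by the EA-CSS construction (below) from an $[n,k_X,d_X]_q$ code $\mathcal C_X$ and an $[n,k_Z,d_Z]_q$ code $\mathcal C_Z$ satisfying: for every $i\in[n]$ there exist $\mathbf h_i^X\in\mathcal C_X^\perp$, $\mathbf h_i^Z\in\mathcal C_Z^\perp$ with $i\in\mathrm{supp}(\mathbf h_i^X)\cap\mathrm{supp}(\mathbf h_i^Z)$ and $|\mathrm{supp}(\mathbf h_i^X)\cup\mathrm{supp}(\mathbf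 h_i^Z)|\le r+1$. Its parameters $[[n,\kappa,\delta;c]]_q$ ($n$ transmitted qudits, $\kappa$ logical qudits, minimum distance $\delta$, $c$ maximally entangled pairs) are $$c=n-k_X-\dim(\mathcal C_X^\perp\cap\mathcal C_Z)=n-k_Z-\dim(\mathcal C_X\cap\mathcal C_Z^\perp),\qquad\kappa=k_X+k_Z-n+c,$$ and $\delta=\min\{d_X,d_Z\}$ if $\mathcal C_X\subseteq\mathcal C_Z^\perp$, and otherwise $\delta=\min\{\mathrm{wt}(\mathcal C_X\setminus(\mathcal C_X\cap\mathcal C_Z^\perp)),\ \mathrm{wt}(\mathcal C_Z\setminus(\mathcal C_X^\perp\cap\mathcal C_Z))\}$. It is pure if $\delta=\min\{d_X,d_Z\}$. EA-CSS construction. With $q=p^m$, qudit basis $\{|x\rangle:x\in\mathbb F_q\}$, $X(a)|x\rangle=|x+a\rangle$, $Z(b)|x\rangle=e^{2\pi i\,{\rm tr}(bx)/p}|x\rangle$ (${\rm tr}:\mathbb F_q\to\mathbb F_p$ the trace), tensor products $X_A(\mathbf a),Z_A(\mathbf b)$ on a register $A$, parity-check matrices $\mathbf H_X,\mathbf H_Z$ of $\mathcal C_X,\mathcal C_Z$, and a rank factorization $-\mathbf H_X\mathbf H_Z^\top=\mathbf F_X\mathbf F_Z^\top$ where $\mathbf F_X,\mathbf F_Z$ have $c=\mathrm{rank}(\mathbf H_X\mathbf H_Z^\top)$ columns, $\mathcal Q(\mathcal C_X,\mathcal C_Z)$ is the subspace of $\mathcal H_Q\otimes\mathcal H_B=(\mathbb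 C^q)^{\otimes n}\otimes(\mathbb C^q)^{\otimes c}$ (transmitted register $Q=(Q_1,\dots,Q_n)$, noiseless receiver register $B$) fixed by all operators $X_Q(\mathbf u\mathbf H_X)Z_Q(\mathbf v\mathbf H_Z)\otimes X_B(\mathbf u\mathbf F_X)Z_B(\mathbf v\mathbf F_Z)$, $\mathbf u\in\mathbb F_q^{n-k_X}$, $\mathbf v\in\mathbb F_q^{n-k_Z}$. Operational meaning of locality $r$. For every $i\in[n]$ there is $R_i\subseteq[n]\setminus\{i\}$ with $|R_i|\le r$ and a quantum channel (completely positive trace-preserving map) acting on the qudits $Q_{\{i\}\cup R_i}$ and $B$ which maps $\frac{I_{Q_i}}{q}\otimes{\rm Tr}_{Q_i}(|\psi\rangle\langle\psi|)$ back to $|\psi\rangle\langle\psi|$ for every unit vector $|\psi\rangle$ in the code; the paper shows that the support condition above implies this. *)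

theory Defs
  imports
    Complex_Main
    "HOL-Library.Cardinality"
    "HOL-Number_Theory.Prime_Powers"
    "Jordan_Normal_Form.Matrix_Kernel"
    "Jordan_Normal_Form.DL_Rank"
begin

section \<open>Linear codes\<close>

text \<open>
  Words of length \<open>n\<close> are elements of \<^term>\<open>carrier_vec n\<close>; coordinates are numbered
  \<open>0, \<dots>, n - 1\<close>.
\<close>

definition linear_code :: "nat \<Rightarrow> 'a::field vec set \<Rightarrow> bool" where
  "linear_code n C \<longleftrightarrow> VectorSpace.subspace class_ring C (module_vec TYPE('a) n)"

definition code_dim :: "nat \<Rightarrow> 'a::field vec set \<Rightarrow> nat" where
  "code_dim n C = vectorspace.dim class_ring ((module_vec TYPE('a) n)\<lparr>carrier := C\<rparr>)"

definition dual_code :: "nat \<Rightarrow> 'a::field vec set \<Rightarrow> 'a vec set" where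
  "dual_code n C = {y \<in> carrier_vec n. \<forall>x\<in>C. x \<bullet> y = 0}"

definition vsupp :: "'a::zero vec \<Rightarrow> nat set" where
  "vsupp x = {i. i < dim_vec x \<and> x $ i \<noteq> 0}"

text \<open>Meaningful only if \<open>S\<close> contains a nonzero vector.\<close>

definition min_wt :: "nat \<Rightarrow> 'a::zero vec set \<Rightarrow> nat" where
  "min_wt n S = Min ((\<lambda>x. card (vsupp x)) ` (S - {0\<^sub>v n}))"

definition parity_check_matrix :: "nat \<Rightarrow> 'a::field vec set \<Rightarrow> 'a mat \<Rightarrow> bool" where
  "parity_check_matrix n C H \<longleftrightarrow> H \<in> carrier_mat (n - code_dim n C) n \<and> mat_kernel H = C"


section \<open>Qudit operators\<close>

text \<open>
  The character \<open>x \<mapsto> exp (2 \<pi> i tr(x) / p)\<close>, where \<open>p = CHAR('a)\<close>, \<open>CARD('a) = p ^ m\<close> and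
  \<open>tr(x) = x + x ^ p + \<dots> + x ^ (p ^ (m - 1))\<close> lies in the prime field; it is read as its
  representative in \<open>{0, \<dots>, p - 1}\<close>.
\<close>

definition field_trace :: "'a::{field,finite} \<Rightarrow> 'a" where
  "field_trace x = (\<Sum>j < (THE m. CARD('a) = CHAR('a) ^ m). x ^ (CHAR('a) ^ j))"

definition trace_rep :: "'a::{field,finite} \<Rightarrow> nat" where
  "trace_rep x = (THE t. t < CHAR('a) \<and> of_nat t = field_trace x)"

definition add_char :: "'a::{field,finite} \<Rightarrow> complex" where
  "add_char x = exp (2 * of_real pi * \<i> * of_nat (trace_rep x) / of_nat CHAR('a))"

text \<open>
  A vector of \<open>(\<complex>\<^sup>q)\<^sup>\<otimes>\<^sup>n \<otimes> (\<complex>\<^sup>q)\<^sup>\<otimes>\<^sup>c\<close> is given by its coefficients with respect to the basis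
  \<open>|x\<rangle> \<otimes> |y\<rangle>\<close>, \<open>(x, y) \<in> basis_idx n c\<close>, and is extended by 0 to all other arguments.
\<close>

type_synonym 'a state = "'a vec \<times> 'a vec \<Rightarrow> complex"

definition basis_idx :: "nat \<Rightarrow> nat \<Rightarrow> ('a vec \<times> 'a vec) set" where
  "basis_idx n c = carrier_vec n \<times> carrier_vec c"

definition states :: "nat \<Rightarrow> nat \<Rightarrow> 'a state set" where
  "states n c = {\<psi>. \<forall>\<omega>. \<omega> \<notin> basis_idx n c \<longrightarrow> \<psi> \<omega> = 0}"

definition unit_state :: "nat \<Rightarrow> nat \<Rightarrow> 'a state \<Rightarrow> bool" where
  "unit_state n c \<psi> \<longleftrightarrow> (\<Sum>\<omega>\<in>basis_idx n c. (cmod (\<psi> \<omega>))\<^sup>2) = 1"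

text \<open>
  On coefficients, \<open>X(a)|x\<rangle> = |x + a\<rangle>\<close> becomes \<open>\<psi> \<mapsto> (\<lambda>x. \<psi> (x - a))\<close>.
\<close>

definition X_op :: "'a::{field,finite} vec \<Rightarrow> 'a vec \<Rightarrow> 'a state \<Rightarrow> 'a state" where
  "X_op a a' \<psi> = (\<lambda>(x, y). \<psi> (x - a, y - a'))"

definition Z_op :: "'a::{field,finite} vec \<Rightarrow> 'a vec \<Rightarrow> 'a state \<Rightarrow> 'a state" where
  "Z_op b b' \<psi> = (\<lambda>(x, y). (\<Prod>j<dim_vec b. add_char (b $ j * x $ j))
     * (\<Prod>j<dim_vec b'. add_char (b' $ j * y $ j)) * \<psi> (x, y))"


section \<open>The entanglement-assisted CSS construction\<close>

text \<open>
  Row vectors are identified with column vectors, so \<open>u H\<close> is written \<open>H\<^sup>T *\<^sub>v u\<close>.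
\<close>

definition stabilized_space ::
    "nat \<Rightarrow> nat \<Rightarrow> 'a::{field,finite} mat \<Rightarrow> 'a mat \<Rightarrow> 'a mat \<Rightarrow> 'a mat \<Rightarrow> 'a state set" where
  "stabilized_space n c HX HZ FX FZ = {\<psi> \<in> states n c.
     \<forall>u \<in> carrier_vec (dim_row HX). \<forall>v \<in> carrier_vec (dim_row HZ). \<forall>\<omega> \<in> basis_idx n c.
       X_op (HX\<^sup>T *\<^sub>v u) (FX\<^sup>T *\<^sub>v u) (Z_op (HZ\<^sup>T *\<^sub>v v) (FZ\<^sup>T *\<^sub>v v) \<psi>) \<omega> = \<psi> \<omega>}"

text \<open>
  \<open>Q\<close> arises from the construction applied to \<open>CX\<close> and \<open>CZ\<close>, with \<open>c\<close> entangled pairs, for some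
  choice of the parity-check matrices and of the rank factorization.
\<close>

definition ea_css_code ::
    "nat \<Rightarrow> nat \<Rightarrow> 'a::{field,finite} vec set \<Rightarrow> 'a vec set \<Rightarrow> 'a state set \<Rightarrow> bool" where
  "ea_css_code n c CX CZ Q \<longleftrightarrow> (\<exists>HX HZ FX FZ.
     parity_check_matrix n CX HX \<and> parity_check_matrix n CZ HZ \<and>
     c = vec_space.rank (dim_row HX) (HX * HZ\<^sup>T) \<and>
     FX \<in> carrier_mat (dim_row HX) c \<and> FZ \<in> carrier_mat (dim_row HZ) c \<and>
     - (HX * HZ\<^sup>T) = FX * FZ\<^sup>T \<and>
     Q = stabilized_space n c HX HZ FX FZ)"

definition css_support_condition ::
    "nat \<Rightarrow> nat \<Rightarrow> 'a::field vec set \<Rightarrow> 'a vec set \<Rightarrow> bool" where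
  "css_support_condition n r CX CZ \<longleftrightarrow>
     (\<forall>i<n. \<exists>hX \<in> dual_code n CX. \<exists>hZ \<in> dual_code n CZ.
        i \<in> vsupp hX \<inter> vsupp hZ \<and> card (vsupp hX \<union> vsupp hZ) \<le> r + 1)"

definition css_like_eaqlrc ::
    "nat \<Rightarrow> nat \<Rightarrow> nat \<Rightarrow> 'a::{field,finite} vec set \<Rightarrow> 'a vec set \<Rightarrow> 'a state set \<Rightarrow> bool" where
  "css_like_eaqlrc n c r CX CZ Q \<longleftrightarrow>
     linear_code n CX \<and> linear_code n CZ \<and> ea_css_code n c CX CZ Q \<and>
     css_support_condition n r CX CZ"

definition css_distance :: "nat \<Rightarrow> 'a::field vec set \<Rightarrow> 'a vec set \<Rightarrow> nat" where
  "css_distance n CX CZ =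
     (if CX \<subseteq> dual_code n CZ then min (min_wt n CX) (min_wt n CZ)
      else min (min_wt n (CX - (CX \<inter> dual_code n CZ)))
               (min_wt n (CZ - (dual_code n CX \<inter> CZ))))"

text \<open>The parameters \<open>[[n, \<kappa>, \<delta>; c]]\<close>; \<open>\<kappa>\<close> is an integer to avoid truncated subtraction.\<close>

definition css_parameters ::
    "nat \<Rightarrow> int \<Rightarrow> nat \<Rightarrow> nat \<Rightarrow> 'a::field vec set \<Rightarrow> 'a vec set \<Rightarrow> bool" where
  "css_parameters n \<kappa> \<delta> c CX CZ \<longleftrightarrow>
     int c = int n - int (code_dim n CX) - int (code_dim n (dual_code n CX \<inter> CZ)) \<and>
     int c = int n - int (code_dim n CZ) - int (code_dim n (CX \<inter> dual_code n CZ)) \<and>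
     \<kappa> = int (code_dim n CX) + int (code_dim n CZ) - int n + int c \<and>
     \<delta> = css_distance n CX CZ"

definition css_pure :: "nat \<Rightarrow> 'a::field vec set \<Rightarrow> 'a vec set \<Rightarrow> bool" where
  "css_pure n CX CZ \<longleftrightarrow> css_distance n CX CZ = min (min_wt n CX) (min_wt n CZ)"

definition singleton_optimal :: "nat \<Rightarrow> int \<Rightarrow> nat \<Rightarrow> nat \<Rightarrow> nat \<Rightarrow> bool" where
  "singleton_optimal n \<kappa> \<delta> c r \<longleftrightarrow>
     2 * int \<delta> = int n + int c - \<kappa> - 2 * \<lceil>real_of_int \<kappa> / real r\<rceil> + 4"


section \<open>Local recovery by a quantum channel\<close>

text \<open>
  An operator on the space with orthonormal basis indexed by a finite set \<open>L\<close> is given by its matrix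
  entries; only the entries with both indices in \<open>L\<close> are relevant.
\<close>

type_synonym 'b oper = "'b \<Rightarrow> 'b \<Rightarrow> complex"

definition psd_on :: "'b set \<Rightarrow> 'b oper \<Rightarrow> bool" where
  "psd_on L M \<longleftrightarrow> (\<forall>v. let z = (\<Sum>a\<in>L. \<Sum>b\<in>L. cnj (v a) * M a b * v b) in Im z = 0 \<and> Re z \<ge> 0)"

definition linear_superop :: "'b set \<Rightarrow> ('b oper \<Rightarrow> 'b oper) \<Rightarrow> bool" where
  "linear_superop L \<Phi> \<longleftrightarrow>
     (\<forall>M N. (\<forall>a\<in>L. \<forall>b\<in>L. M a b = N a b) \<longrightarrow> (\<forall>a\<in>L. \<forall>b\<in>L. \<Phi> M a b = \<Phi> N a b)) \<and>
     (\<forall>M N. \<forall>a\<in>L. \<forall>b\<in>L. \<Phi> (\<lambda>a b. M a b + N a b) a b = \<Phi> M a b + \<Phi> N a b) \<and>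
     (\<forall>z M. \<forall>a\<in>L. \<forall>b\<in>L. \<Phi> (\<lambda>a b. z * M a b) a b = z * \<Phi> M a b)"

text \<open>Positivity of \<open>\<Phi> \<otimes> id\<close> for ancillas of every finite dimension \<open>k\<close>.\<close>

definition completely_positive :: "'b set \<Rightarrow> ('b oper \<Rightarrow> 'b oper) \<Rightarrow> bool" where
  "completely_positive L \<Phi> \<longleftrightarrow>
     (\<forall>(k::nat) M. psd_on (L \<times> {..<k}) M \<longrightarrow>
        psd_on (L \<times> {..<k}) (\<lambda>(a, i) (b, j). \<Phi> (\<lambda>a' b'. M (a', i) (b', j)) a b))"

definition trace_preserving :: "'b set \<Rightarrow> ('b oper \<Rightarrow> 'b oper) \<Rightarrow> bool" where
  "trace_preserving L \<Phi> \<longleftrightarrow> (\<forall>M. (\<Sum>a\<in>L. \<Phi> M a a) = (\<Sum>a\<in>L. M a a))"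

definition quantum_channel :: "'b set \<Rightarrow> ('b oper \<Rightarrow> 'b oper) \<Rightarrow> bool" where
  "quantum_channel L \<Phi> \<longleftrightarrow>
     linear_superop L \<Phi> \<and> completely_positive L \<Phi> \<and> trace_preserving L \<Phi>"

text \<open>
  For a set \<open>S\<close> of positions, a basis index \<open>x\<close> of the transmitted register splits uniquely as
  \<open>restrict_vec S x + restrict_vec (- S) x\<close>. This identifies the basis of the qudits at the positions
  in \<open>S\<close> together with the receiver register with \<open>local_idx n c S\<close>; \<open>local_apply S \<Phi>\<close> is
  \<open>\<Phi> \<otimes> id\<close>, where \<open>id\<close> refers to the qudits at the positions outside \<open>S\<close>.
\<close>

definition restrict_vec :: "nat set \<Rightarrow> 'a::zero vec \<Rightarrow> 'a vec" where
  "restrict_vec S x = vec (dim_vec x) (\<lambda>j. if j \<in> S then x $ j else 0)"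

definition local_idx :: "nat \<Rightarrow> nat \<Rightarrow> nat set \<Rightarrow> ('a::zero vec \<times> 'a vec) set" where
  "local_idx n c S = {x \<in> carrier_vec n. vsupp x \<subseteq> S} \<times> carrier_vec c"

definition local_apply :: "nat set \<Rightarrow> (('a::field vec \<times> 'a vec) oper \<Rightarrow> ('a vec \<times> 'a vec) oper)
    \<Rightarrow> ('a vec \<times> 'a vec) oper \<Rightarrow> ('a vec \<times> 'a vec) oper" where
  "local_apply S \<Phi> \<rho> = (\<lambda>(x, y) (x', y').
     \<Phi> (\<lambda>(w, v) (w', v'). \<rho> (w + restrict_vec (- S) x, v) (w' + restrict_vec (- S) x', v'))
       (restrict_vec S x, y) (restrict_vec S x', y'))"

definition set_coord :: "'a vec \<Rightarrow> nat \<Rightarrow> 'a \<Rightarrow> 'a vec" where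
  "set_coord x i t = vec (dim_vec x) (\<lambda>j. if j = i then t else x $ j)"

definition pure_density :: "'a state \<Rightarrow> ('a vec \<times> 'a vec) oper" where
  "pure_density \<psi> = (\<lambda>\<omega> \<omega>'. \<psi> \<omega> * cnj (\<psi> \<omega>'))"

text \<open>The operator \<open>I/q \<otimes> Tr(\<rho>)\<close>, with the identity and the partial trace at position \<open>i\<close>.\<close>

definition erase_qudit ::
    "nat \<Rightarrow> ('a::{field,finite} vec \<times> 'a vec) oper \<Rightarrow> ('a vec \<times> 'a vec) oper" where
  "erase_qudit i \<rho> = (\<lambda>(x, y) (x', y').
     (if x $ i = x' $ i then 1 / of_nat CARD('a) else 0) *
     (\<Sum>t\<in>UNIV. \<rho> (set_coord x i t, y) (set_coord x' i t, y')))"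

definition locally_recoverable :: "nat \<Rightarrow> nat \<Rightarrow> nat \<Rightarrow> 'a::{field,finite} state set \<Rightarrow> bool" where
  "locally_recoverable n c r Q \<longleftrightarrow>
     (\<forall>i<n. \<exists>R \<subseteq> {..<n} - {i}. card R \<le> r \<and>
       (\<exists>\<Phi>. quantum_channel (local_idx n c (insert i R)) \<Phi> \<and>
         (\<forall>\<psi>\<in>Q. unit_state n c \<psi> \<longrightarrow>
           (\<forall>\<omega>\<in>basis_idx n c. \<forall>\<omega>'\<in>basis_idx n c.
             local_apply (insert i R) \<Phi> (erase_qudit i (pure_density \<psi>)) \<omega> \<omega>' =
             pure_density \<psi> \<omega> \<omega>'))))"

end

theory Submission
  imports Defs
    "Berlekamp_Zassenhaus.Berlekamp_Type_Based"
    "HOL-Number_Theory.Residues"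
begin

text \<open>
  Split the \<open>n = u (r + 1)\<close> positions into \<open>u\<close> blocks and label the positions of block \<open>k\<close> by the
  points \<open>\<beta>\<^sub>k \<omega>\<close>, where \<open>\<omega>\<close> runs through the \<open>(r + 1)\<close>-th roots of unity. Both codes are checked by
  the block indicators and by \<open>d - 2\<close> powers of the points, namely \<open>x, \<dots>, x\<^bsup>d-2\<^esup>\<close> for \<open>\<C>\<^sub>X\<close> and
  \<open>x\<^bsup>-s\<^esup>, \<dots>, x\<^bsup>-1\<^esup>, x, \<dots>, x\<^bsup>d-2-s\<^esup>\<close> for \<open>\<C>\<^sub>Z\<close>. Every column of the second matrix is multiplied by
  a block weight \<open>v\<^sub>k\<close> with \<open>\<Sum>\<^sub>k v\<^sub>k \<noteq> 0\<close>. A sum of \<open>x\<^bsup>e\<^esup>\<close> with \<open>0 < \<bar>e\<bar> \<le> r\<close> over a block vanishes,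
  hence \<open>H\<^sub>X H\<^sub>Z\<^sup>T\<close> is diagonal with exactly \<open>u + s\<close> nonzero entries; this yields all dimensions.

  With the exponent 0 coming from the block indicators, each matrix contains a Vandermonde matrix with
  \<open>d - 1\<close> rows, so that the minimum weights are at least \<open>d\<close>. For \<open>d \<ge> 5\<close> the \<open>\<beta>\<^sub>k\<close> represent
  distinct cosets and all points are distinct; for \<open>d \<le> 4\<close> take \<open>\<beta>\<^sub>k = 1\<close>: a codeword meets each
  block in no or at least two positions, so a codeword of weight at most 3 lives in a single block.
  Conversely \<open>\<C>\<^sub>X\<close> contains a word of weight \<open>d\<close> inside the first block. If it lay in
  \<open>\<C>\<^sub>Z\<^sup>\<bottom>\<close>, it would by orthogonality be given by a combination of \<open>x, \<dots>, x\<^bsup>d-2-s\<^esup>\<close>, which has too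
  few zeros.

  An erased qudit is recovered from a stabilizer of type \<open>X\<close> and one of type \<open>Z\<close> that act on its block
  and on the receiver register: the latter determines the erased symbol in the computational basis, and
  the former moves it to any prescribed value without changing the state.
\<close>

section \<open>Additive characters and roots of unity in finite fields\<close>

lemma prime_CHAR_finite_field: "prime CHAR('a::{field,finite})"
  by (rule prime_CHAR_semidom) (rule finite_imp_CHAR_pos, simp)

lemma CARD_eq_power_CHAR:
  assumes "primepow CARD('a::{field,finite})"
  obtains m where "m > 0" "CARD('a) = CHAR('a) ^ m"
proof -
  obtain p m where pm: "prime p" "m > 0" "CARD('a) = p ^ m"
    using assms unfolding primepow_def by blast
  have "CHAR('a) dvd p ^ m" using CHAR_dvd_CARD[where ?'a = 'a] pm by simp
  then have "CHAR('a) = p"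
    using prime_CHAR_finite_field[where ?'a = 'a] pm(1) prime_dvd_power primes_dvd_imp_eq by blast
  then show ?thesis using pm that by blast
qed

lemma nonzero_power_CARD:
  fixes x :: "'a::{field,finite}"
  assumes "x \<noteq> 0"
  shows "x ^ (CARD('a) - 1) = 1"
proof -
  have "(\<Prod>y\<in>UNIV-{0}. x * y) = (\<Prod>y\<in>UNIV-{0}. y)"
    by (rule prod.reindex_bij_witness[of _ "\<lambda>y. y / x" "\<lambda>y. x * y"]) (use assms in auto)
  then have "x ^ (CARD('a) - 1) * \<Prod>(UNIV-{0}) = 1 * \<Prod>(UNIV-{0})"
    by (simp add: prod.distrib card_Diff_singleton)
  then show ?thesis by (metis (no_types, lifting) DiffE finite_Diff finite insertI1 mult_right_cancel prod_zero_iff)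
qed

lemma power_CARD_eq: "(x::'a::{field,finite}) ^ CARD('a) = x"
proof (cases "x = 0")
  case False
  have "x ^ CARD('a) = x * x ^ (CARD('a) - 1)" by (rule power_eq_if[THEN trans]) simp
  then show ?thesis using nonzero_power_CARD[OF False] by simp
qed simp

text \<open>The prime field has p elements, all fixed by Frobenius, while the fixed points are roots
  of X^p - X and hence at most p in number. This identifies the range of the trace.\<close>

lemma range_of_nat_eq_frobenius_fixed:
  "of_nat ` {..<CHAR('a)} = {y::'a::{field,finite}. y ^ CHAR('a) = y}"
proof -
  let ?p = "CHAR('a)"
  let ?F = "{y::'a. y ^ ?p = y}"
  have pr: "prime ?p" by (rule prime_CHAR_finite_field)
  then have p1: "?p > 1" by (rule prime_gt_1_nat)
  have fixed: "(of_nat t :: 'a) ^ ?p = of_nat t" for t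
  proof (induction t)
    case (Suc t)
    then show ?case using freshmans_dream[OF pr refl, of 1 "of_nat t"] by simp
  qed (use p1 in \<open>simp add: power_0_left\<close>)
  have inj: "inj_on (of_nat :: nat \<Rightarrow> 'a) {..<?p}"
    by (auto intro!: inj_onI simp: of_nat_eq_iff_cong_CHAR cong_def)
  let ?P = "Polynomial.monom 1 ?p - Polynomial.monom 1 1 :: 'a poly"
  have "Polynomial.coeff ?P ?p = 1" using p1 by simp
  then have P0: "?P \<noteq> 0" by (metis Polynomial.coeff_0 zero_neq_one)
  have "card ?F = card {y. poly ?P y = 0}" by (simp add: poly_monom)
  also have "\<dots> \<le> degree ?P" by (rule card_poly_roots_bound[OF P0])
  also have "\<dots> \<le> ?p" using p1
    by (intro degree_diff_le) (auto intro: order.trans[OF degree_monom_le])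
  also have "?p = card (of_nat ` {..<?p} :: 'a set)" using inj by (simp add: card_image)
  finally show ?thesis by (intro card_seteq) (auto simp: fixed)
qed

context
  assumes pp: "primepow CARD('a::{field,finite})"
begin

lemma field_trace_eq:
  fixes x :: "'a"
  assumes "CARD('a) = CHAR('a) ^ m"
  shows "field_trace x = (\<Sum>j<m. x ^ (CHAR('a) ^ j))"
proof -
  have "CHAR('a) > 1" by (rule prime_gt_1_nat[OF prime_CHAR_finite_field])
  then have "(THE m. CARD('a) = CHAR('a) ^ m) = m" using assms by (intro the_equality) simp_all
  then show ?thesis by (simp add: field_trace_def)
qed

lemma field_trace_add: "field_trace (x + y) = field_trace x + field_trace (y::'a)"
proof -
  obtain m where "CARD('a) = CHAR('a) ^ m" using CARD_eq_power_CHAR[OF pp] by blast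
  then show ?thesis using prime_CHAR_finite_field[where ?'a = 'a]
    by (simp add: field_trace_eq freshmans_dream' sum.distrib)
qed

text \<open>Frobenius shifts the conjugates cyclically: the last one becomes x^q, which is x
  again.\<close>

lemma field_trace_power_CHAR: "field_trace x ^ CHAR('a) = field_trace (x::'a)"
proof -
  obtain m where m: "CARD('a) = CHAR('a) ^ m" "m > 0" using CARD_eq_power_CHAR[OF pp] by blast
  then obtain k where k: "m = Suc k" by (cases m) auto
  have "field_trace x ^ CHAR('a) = (\<Sum>j<m. (x ^ (CHAR('a) ^ j)) ^ CHAR('a))"
    using m prime_CHAR_finite_field[where ?'a = 'a] by (simp add: field_trace_eq freshmans_dream_sum)
  also have "\<dots> = (\<Sum>j<m. x ^ (CHAR('a) ^ Suc j))"
    by (intro sum.cong refl) (simp add: mult.commute flip: power_mult)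
  also have "\<dots> = (\<Sum>j<k. x ^ (CHAR('a) ^ Suc j)) + x ^ CARD('a)" using m k by simp
  also have "\<dots> = (\<Sum>j<m. x ^ (CHAR('a) ^ j))"
    unfolding power_CARD_eq k sum.lessThan_Suc_shift by simp
  finally show ?thesis using m by (simp add: field_trace_eq)
qed

text \<open>Resolves the definite description: the trace is fixed by Frobenius and so lies in the
  prime field, and residues below p are determined by their congruence class.\<close>

lemma trace_rep: "trace_rep (x::'a) < CHAR('a)" "of_nat (trace_rep x) = field_trace x"
proof -
  have "field_trace x \<in> of_nat ` {..<CHAR('a)}"
    using field_trace_power_CHAR[of x] by (simp add: range_of_nat_eq_frobenius_fixed)
  then obtain t where t: "t < CHAR('a) \<and> of_nat t = field_trace x" by auto
  have "\<exists>!t. t < CHAR('a) \<and> of_nat t = field_trace x"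
  proof (rule ex1I[of _ t])
    show "t < CHAR('a) \<and> of_nat t = field_trace x" by (rule t)
    fix t' assume t': "t' < CHAR('a) \<and> of_nat t' = field_trace x"
    then have "[t' = t] (mod CHAR('a))"
      using t by (simp flip: of_nat_eq_iff_cong_CHAR)
    then show "t' = t" using t t' by (simp add: cong_def)
  qed
  from theI'[OF this] show "trace_rep x < CHAR('a)" "of_nat (trace_rep x) = field_trace x"
    unfolding trace_rep_def by auto
qed

text \<open>The representative of a sum differs from the sum of the representatives by a multiple of
  p, which contributes only a power of exp(2 pi i) = 1.\<close>

lemma add_char_add: "add_char (x + y) = add_char x * add_char (y::'a)"
proof -
  let ?p = "CHAR('a)"
  have "(of_nat (trace_rep (x + y)) :: 'a) = of_nat (trace_rep x + trace_rep y)"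
    by (simp add: trace_rep(2) field_trace_add)
  then have "[trace_rep (x + y) = trace_rep x + trace_rep y] (mod ?p)"
    by (simp only: of_nat_eq_iff_cong_CHAR)
  then have "trace_rep (x + y) = (trace_rep x + trace_rep y) mod ?p"
    using trace_rep(1)[of "x + y"] by (simp add: cong_def)
  then have "trace_rep x + trace_rep y = trace_rep (x + y) + ?p * ((trace_rep x + trace_rep y) div ?p)"
    by simp
  then obtain k where k: "trace_rep x + trace_rep y = trace_rep (x + y) + ?p * k" by blast
  have p0: "?p > 0" using trace_rep(1)[of x] by simp
  have "add_char x * add_char y =
      exp (2 * of_real pi * \<i> * of_nat (trace_rep x + trace_rep y) / of_nat ?p)"
    unfolding add_char_def exp_add[symmetric] by (simp add: field_simps add_divide_distrib)
  also have "2 * of_real pi * \<i> * of_nat (trace_rep x + trace_rep y) / (of_nat ?p :: complex) =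
     2 * of_real pi * \<i> * of_nat (trace_rep (x + y)) / of_nat ?p + of_nat k * (2 * of_real pi * \<i>)"
    unfolding k using p0 by (simp add: field_simps)
  also have "exp \<dots> = add_char (x + y) * exp (2 * of_real pi * \<i>) ^ k"
    unfolding exp_add add_char_def exp_of_nat_mult ..
  finally show ?thesis by simp
qed

lemma add_char_0: "add_char (0::'a) = 1"
proof -
  have "add_char (0::'a) \<noteq> 0" by (simp add: add_char_def)
  then show ?thesis using add_char_add[of 0 0] by simp
qed

lemma add_char_sum: "add_char (sum f A) = (\<Prod>j\<in>A. add_char (f j :: 'a))"
  by (induction A rule: infinite_finite_induct) (auto simp: add_char_0 add_char_add)

text \<open>As a polynomial the trace has degree at most p^(m-1) < q and coefficient 1 at X, so it
  cannot vanish on the whole field.\<close>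

lemma field_trace_nonzero: "\<exists>x::'a. field_trace x \<noteq> 0"
proof (rule ccontr)
  assume "\<not> ?thesis"
  then have tr0: "field_trace x = 0" for x :: 'a by blast
  let ?p = "CHAR('a)"
  have p1: "?p > 1" using prime_CHAR_finite_field prime_gt_1_nat by blast
  obtain m where m: "CARD('a) = ?p ^ m" "m > 0" using CARD_eq_power_CHAR[OF pp] by blast
  define P :: "'a poly" where "P = (\<Sum>j<m. Polynomial.monom 1 (?p ^ j))"
  \<comment> \<open>The exponent 1 is written \<open>?p ^ 0\<close> so that comparing exponents
    reduces to injectivity of powers of p.\<close>
  have "Polynomial.coeff P (?p ^ 0) = (\<Sum>j<m. if j = 0 then 1 else 0)"
    unfolding P_def Polynomial.coeff_sum Polynomial.coeff_monom using p1 by (intro sum.cong refl) (auto simp: power_inject_exp simp del: power_0)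
  then have P0: "P \<noteq> 0" using m by (auto simp: sum.delta)
  have "degree P \<le> ?p ^ (m - 1)"
    unfolding P_def
    by (intro degree_sum_le) (use p1 in \<open>auto intro!: order.trans[OF degree_monom_le] power_increasing\<close>)
  also have "\<dots> < CARD('a)" unfolding m(1) using m(2) p1 by (intro power_strict_increasing) auto
  finally have "degree P < CARD('a)" .
  moreover have "poly P x = 0" for x
    using tr0[of x] by (simp add: P_def poly_sum poly_monom field_trace_eq[OF m(1)])
  then have "{x. poly P x = 0} = UNIV" by auto
  ultimately show False using card_poly_roots_bound[OF P0] by simp
qed

lemma add_char_eq_1_iff: "add_char (x::'a) = 1 \<longleftrightarrow> field_trace x = 0"
proof
  let ?p = "CHAR('a)"
  assume "add_char x = 1"
  then have "Re (add_char x) = 1" by simp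
  then have "cos (2 * pi * real (trace_rep x) / real ?p) = 1" by (simp add: add_char_def Re_exp)
  then obtain n :: int where n: "2 * pi * real (trace_rep x) / real ?p = of_int n * 2 * pi"
    unfolding cos_one_2pi_int by blast
  have p0: "?p > 0" using trace_rep(1)[of x] by simp
  have "real (trace_rep x) = of_int n * real ?p" using n p0 by (simp add: field_simps)
  then have "int (trace_rep x) = n * int ?p" by (metis of_int_eq_iff of_int_mult of_int_of_nat_eq)
  then have "int ?p dvd int (trace_rep x)" by simp
  then have "?p dvd trace_rep x" by simp
  then show "field_trace x = 0" using trace_rep[of x] by (metis of_nat_eq_0_iff_char_dvd)
next
  assume "field_trace x = 0"
  then have "CHAR('a) dvd trace_rep x" using trace_rep(2)[of x] by (simp add: of_nat_eq_0_iff_char_dvd)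
  then have "trace_rep x = 0" using trace_rep(1)[of x] by (auto dest: dvd_imp_le)
  then show "add_char x = 1" by (simp add: add_char_def)
qed

text \<open>Nondegeneracy of the trace pairing: for t \<noteq> 0 the products b t run through the
  whole field. It turns invariance under all multiples of a Z-type stabilizer into a linear equation
  on the support of a state.\<close>

lemma add_char_separates:
  assumes "\<And>b. add_char (b * t) = 1"
  shows "t = (0::'a)"
proof (rule ccontr)
  assume "t \<noteq> 0"
  then have "add_char x = 1" for x :: 'a using assms[of "x / t"] by simp
  then show False using field_trace_nonzero add_char_eq_1_iff by blast
qed

end

section \<open>Roots of unity, block weights and Vandermonde systems\<close>

text \<open>Write q - 1 = N m. The map x -> x^m sends the q - 1 nonzero elements to N-th roots of
  unity with fibres of size at most m, so there are at least N such roots; the degree of X^N - 1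
  gives the other bound.\<close>

lemma card_roots_of_unity:
  assumes "N dvd CARD('a::{field,finite}) - 1" "N > 0"
  shows "card {x::'a. x ^ N = 1} = N"
proof (rule antisym)
  have root_bound: "card {x::'a. x ^ k = y} \<le> k" if "k > 0" for k y
  proof -
    let ?P = "Polynomial.monom 1 k - [:y:] :: 'a poly"
    have "Polynomial.coeff ?P k = 1" using that by (simp add: coeff_pCons split: nat.split)
    then have "?P \<noteq> 0" by (metis Polynomial.coeff_0 zero_neq_one)
    moreover have "degree ?P \<le> k"
      by (intro degree_diff_le) (auto intro: order.trans[OF degree_monom_le])
    ultimately show ?thesis using card_poly_roots_bound[of ?P] by (simp add: poly_monom)
  qed
  show "card {x::'a. x ^ N = 1} \<le> N" by (rule root_bound[OF assms(2)])
  obtain m where m: "CARD('a) - 1 = N * m" using assms(1) by blast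
  have "1 < CARD('a)" using card_mono[of UNIV "{0::'a,1}"] by simp
  then have m0: "m > 0" using m by (cases m) auto
  let ?U = "{x::'a. x ^ N = 1}"
  have "UNIV - {0::'a} \<subseteq> (\<Union>y\<in>?U. {x. x ^ m = y})"
  proof
    fix x :: 'a assume "x \<in> UNIV - {0}"
    then have "(x ^ m) ^ N = 1"
      using nonzero_power_CARD[of x] unfolding m by (simp add: mult.commute flip: power_mult)
    then show "x \<in> (\<Union>y\<in>?U. {x. x ^ m = y})" by simp
  qed
  then have "card (UNIV - {0::'a}) \<le> card (\<Union>y\<in>?U. {x::'a. x ^ m = y})"
    by (intro card_mono) auto
  also have "\<dots> \<le> (\<Sum>y\<in>?U. card {x::'a. x ^ m = y})" by (rule card_UN_le) simp
  also have "\<dots> \<le> card ?U * m" using root_bound[OF m0] sum_bounded_above[of ?U _ m] by auto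
  finally have "N * m \<le> card ?U * m" by (simp add: m[symmetric] card_Diff_singleton)
  then show "N \<le> card ?U" using m0 by simp
qed

text \<open>For k \<noteq> 0 some root y has y^k \<noteq> 1, since X^|k| - 1 has fewer than N zeros.
  Multiplication by y permutes the roots and scales the sum by y^k.\<close>

lemma sum_roots_of_unity_powi:
  assumes "N dvd CARD('a::{field,finite}) - 1" "\<bar>k\<bar> < int N"
  shows "(\<Sum>x | x ^ N = (1::'a). x powi k) = (if k = 0 then of_nat N else 0)"
proof -
  let ?U = "{x::'a. x ^ N = 1}"
  have N0: "N > 0" using assms(2) by auto
  note cardU = card_roots_of_unity[OF assms(1) N0]
  show ?thesis
  proof (cases "k = 0")
    case True
    then show ?thesis by (simp add: cardU)
  next
    case False
    define j where "j = nat \<bar>k\<bar>"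
    have j: "j > 0" "j < N" using assms(2) False by (auto simp: j_def)
    have "\<exists>y\<in>?U. y powi k \<noteq> 1"
    proof (rule ccontr)
      assume "\<not> ?thesis"
      then have "x ^ j = 1" if "x \<in> ?U" for x
        using that by (auto simp: power_int_def j_def abs_if power_inverse split: if_splits)
      then have "?U \<subseteq> {x. poly (Polynomial.monom 1 j - 1) x = 0}" by (auto simp: poly_monom)
      then have "card ?U \<le> card {x. poly (Polynomial.monom 1 j - 1 :: 'a poly) x = 0}"
        by (intro card_mono) auto
      also have "Polynomial.coeff (Polynomial.monom 1 j - 1 :: 'a poly) j = 1" using j by simp
      then have "(Polynomial.monom 1 j - 1 :: 'a poly) \<noteq> 0" by (metis Polynomial.coeff_0 zero_neq_one)
      then have "card {x. poly (Polynomial.monom 1 j - 1 :: 'a poly) x = 0} \<le> degree (Polynomial.monom 1 j - 1 :: 'a poly)"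
        by (rule card_poly_roots_bound)
      also have "\<dots> \<le> j" by (intro degree_diff_le) (auto intro: degree_monom_le)
      finally show False using j cardU by simp
    qed
    then obtain y :: 'a where y: "y ^ N = 1" "y powi k \<noteq> 1" by blast
    then have y0: "y \<noteq> 0" using N0 by (auto simp: power_0_left)
    have "(\<Sum>x\<in>?U. x powi k) = (\<Sum>x\<in>?U. (y * x) powi k)"
      by (rule sum.reindex_bij_witness[of _ "\<lambda>x. y * x" "\<lambda>x. x / y"])
         (use y y0 in \<open>auto simp: power_mult_distrib power_divide\<close>)
    also have "\<dots> = y powi k * (\<Sum>x\<in>?U. x powi k)"
      by (simp add: power_int_mult_distrib sum_distrib_left)
    finally have "(1 - y powi k) * (\<Sum>x\<in>?U. x powi k) = 0" by (simp add: algebra_simps)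
    then show ?thesis using y(2) False by simp
  qed
qed

text \<open>Distinct values of \<open>x ^ N\<close> belong to distinct cosets of the group of \<open>N\<close>-th roots of unity.\<close>

lemma distinct_coset_representatives:
  assumes "N dvd CARD('a::{field,finite}) - 1" "N > 0" "u * N \<le> CARD('a) - 1"
  obtains \<beta> :: "nat \<Rightarrow> 'a::{field,finite}" where "\<And>k. \<beta> k \<noteq> 0" "inj_on (\<lambda>k. \<beta> k ^ N) {..<u}"
proof -
  let ?G = "(\<lambda>x::'a. x ^ N) ` (UNIV - {0})"
  have fib: "card {x::'a. x \<noteq> 0 \<and> x ^ N = y} \<le> N" if y: "y \<in> ?G" for y
  proof -
    obtain z where z: "z \<noteq> 0" "y = z ^ N" using y by blast
    have "bij_betw (\<lambda>x. x / z) {x::'a. x \<noteq> 0 \<and> x ^ N = y} {x. x ^ N = 1}"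
      by (rule bij_betwI[of _ _ _ "\<lambda>x. x * z"])
         (use z assms(2) in \<open>auto simp: power_divide power_mult_distrib power_0_left\<close>)
    then show ?thesis using card_roots_of_unity[OF assms(1,2)] by (simp add: bij_betw_same_card)
  qed
  have "card (UNIV - {0::'a}) = card (\<Union>y\<in>?G. {x::'a. x \<noteq> 0 \<and> x ^ N = y})"
    by (rule arg_cong[of _ _ card]) auto
  also have "\<dots> \<le> (\<Sum>y\<in>?G. card {x::'a. x \<noteq> 0 \<and> x ^ N = y})"
    by (rule card_UN_le) simp
  also have "\<dots> \<le> card ?G * N" using fib sum_bounded_above[of ?G _ N] by auto
  finally have "CARD('a) - 1 \<le> card ?G * N" by (simp add: card_Diff_singleton)
  then have "u * N \<le> card ?G * N" using assms(3) by (rule order.trans[rotated])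
  then have "u \<le> card ?G" using assms(2) by (rule mult_right_le_imp_le)
  then obtain f where f: "inj_on f {..<u}" "f ` {..<u} \<subseteq> ?G"
    by (metis card_le_inj card_lessThan finite finite_lessThan)
  have "\<exists>x::'a. x \<noteq> 0 \<and> (k < u \<longrightarrow> x ^ N = f k)" for k
  proof (cases "k < u")
    case True
    then have "f k \<in> ?G" using f by blast
    then show ?thesis by auto
  qed (auto intro: exI[of _ 1])
  then obtain \<beta> where \<beta>: "\<And>k. \<beta> k \<noteq> 0 \<and> (k < u \<longrightarrow> \<beta> k ^ N = f k)" by metis
  show ?thesis
    by (rule that[of \<beta>]) (use \<beta> f(1) in \<open>auto simp: inj_on_def\<close>)
qed

text \<open>Constant weights 1 fail only if the characteristic divides u; replacing one of them by
  some a other than 0 and 1 then gives the sum a - 1.\<close>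

lemma nonzero_weights_with_nonzero_sum:
  assumes "CARD('a::{field,finite}) > 2" "u > 0"
  obtains v :: "nat \<Rightarrow> 'a::{field,finite}" where "\<And>k. v k \<noteq> 0" "(\<Sum>k<u. v k) \<noteq> 0"
proof (cases "of_nat u = (0::'a)")
  case False
  then show ?thesis using that[of "\<lambda>_. 1"] by simp
next
  case True
  have "\<not> UNIV \<subseteq> {0::'a, 1}" using card_mono[of "{0::'a, 1}" UNIV] assms(1) by auto
  then obtain a :: 'a where a: "a \<noteq> 0" "a \<noteq> 1" by auto
  have "(\<Sum>k<u. if k = 0 then a else 1) = (\<Sum>k<u. 1 + (if k = 0 then a - 1 else 0))"
    by (intro sum.cong) auto
  also have "\<dots> = of_nat u + (a - 1)" using assms(2) by (simp add: sum.distrib)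
  finally show ?thesis using True a that[of "\<lambda>k. if k = 0 then a else 1"] by simp
qed

text \<open>Combining the equations with the coefficients of the polynomial that vanishes at all
  points except x j isolates the term of j. The exponents may start at any integer a, because a
  common factor x^a at nonzero points is harmless.\<close>

lemma vandermonde_independent:
  fixes x c :: "'i \<Rightarrow> 'a::field"
  assumes "finite S" "inj_on x S" "\<And>j. j \<in> S \<Longrightarrow> x j \<noteq> 0" "card S \<le> m"
    and zero: "\<And>k. k < m \<Longrightarrow> (\<Sum>j\<in>S. c j * x j powi (a + int k)) = 0"
    and "j \<in> S"
  shows "c j = 0"
proof -
  let ?P = "\<Prod>i\<in>S - {j}. [:- x i, 1:]"
  have "degree ?P = card (S - {j})" by (subst degree_prod_eq_sum_degree) auto
  then have deg: "degree ?P < m"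
    using assms(1,4,6) by (metis card_Diff1_less order_less_le_trans)
  have "(\<Sum>i\<in>S. c i * x i powi a * poly ?P (x i)) =
      (\<Sum>i\<in>S. \<Sum>k<m. Polynomial.coeff ?P k * (c i * x i powi (a + int k)))"
  proof (intro sum.cong refl)
    fix i assume "i \<in> S"
    then have "x i \<noteq> 0" by (rule assms(3))
    moreover have "poly ?P (x i) = (\<Sum>k<m. Polynomial.coeff ?P k * x i ^ k)"
      unfolding poly_altdef using deg
      by (intro sum.mono_neutral_left) (auto simp: coeff_eq_0)
    ultimately show "c i * x i powi a * poly ?P (x i) = (\<Sum>k<m. Polynomial.coeff ?P k * (c i * x i powi (a + int k)))"
      by (simp add: sum_distrib_left power_int_add mult_ac)
  qed
  also have "\<dots> = (\<Sum>k<m. Polynomial.coeff ?P k * (\<Sum>i\<in>S. c i * x i powi (a + int k)))"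
    by (subst sum.swap) (simp add: sum_distrib_left)
  also have "\<dots> = 0" by (simp add: zero)
  also have "(\<Sum>i\<in>S. c i * x i powi a * poly ?P (x i)) = (\<Sum>i\<in>S. if i = j then c j * x j powi a * poly ?P (x j) else 0)"
    using assms(1,6) by (intro sum.cong refl) (auto simp: poly_prod)
  finally have "c j * x j powi a * poly ?P (x j) = 0" using assms(1,6) by simp
  moreover have "poly ?P (x j) \<noteq> 0" using assms(1,2,6) by (auto simp: poly_prod inj_on_def)
  moreover have "x j powi a \<noteq> 0" using assms(3,6) by simp
  ultimately show ?thesis by (metis mult_eq_0_iff)
qed

section \<open>Linear codes given by parity-check matrices\<close>

lemma linear_code_subset: "linear_code n C \<Longrightarrow> C \<subseteq> carrier_vec n"
  unfolding linear_code_def subspace_def submodule_def by (auto simp: module_vec_simps)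

text \<open>Coordinates with respect to a basis are unique, so the codewords correspond to functions
  from the basis to the field. Dimensions below are read off from cardinalities.\<close>

lemma card_linear_code:
  fixes C :: "'a::{field,finite} vec set"
  assumes "linear_code n C"
  shows "card C = CARD('a) ^ code_dim n C"
proof -
  interpret V: vec_space "TYPE('a)" n .
  let ?W = "(module_vec TYPE('a) n)\<lparr>carrier := C\<rparr>"
  have sub: "C \<subseteq> carrier_vec n" by (rule linear_code_subset[OF assms])
  interpret W: vectorspace class_ring ?W
    using V.subspace_is_vs assms unfolding linear_code_def by blast
  have fin: "finite C" by (rule finite_subset[OF sub]) simp
  have "W.fin_dim"
    unfolding W.fin_dim_def using fin W.span_is_subset2[of C] W.in_own_span[of C] by (auto intro!: exI[of _ C])
  then obtain B where B: "finite B" "W.basis B" using W.finite_basis_exists by blast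
  have dim: "code_dim n C = card B"
    unfolding code_dim_def using W.dim_basis[OF B] .
  have BC: "B \<subseteq> carrier ?W" using B by (auto simp: W.basis_def)
  have ex: "\<exists>!a. a \<in> B \<rightarrow>\<^sub>E UNIV \<and> W.lincomb a B = v" if "v \<in> C" for v
    using W.basis_criterion[OF B(1) BC] B(2) that by (simp add: class_ring_simps)
  have "bij_betw (\<lambda>a. W.lincomb a B) (B \<rightarrow>\<^sub>E UNIV) C"
    unfolding bij_betw_def
  proof
    have cl: "W.lincomb a B \<in> C" for a
      using W.lincomb_closed[OF BC, of a] by (simp add: class_ring_simps)
    show "inj_on (\<lambda>a. W.lincomb a B) (B \<rightarrow>\<^sub>E UNIV)"
      using ex cl unfolding inj_on_def by blast
    show "(\<lambda>a. W.lincomb a B) ` (B \<rightarrow>\<^sub>E UNIV) = C"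
      using ex cl by blast
  qed
  then have "card C = card (B \<rightarrow>\<^sub>E (UNIV :: 'a set))" by (simp add: bij_betw_same_card)
  also have "\<dots> = CARD('a) ^ card B" using B(1) by (simp add: card_funcsetE)
  finally show ?thesis using dim by simp
qed

lemma code_dim_eqI:
  fixes C :: "'a::{field,finite} vec set"
  assumes "linear_code n C" "card C = CARD('a) ^ k"
  shows "code_dim n C = k"
proof -
  have "1 < CARD('a)" using card_mono[of UNIV "{0::'a,1}"] by simp
  then show ?thesis using card_linear_code[OF assms(1)] assms(2) by simp
qed

lemma linear_codeI:
  fixes C :: "'a::field vec set"
  assumes "C \<subseteq> carrier_vec n" "0\<^sub>v n \<in> C"
    and "\<And>x y. x \<in> C \<Longrightarrow> y \<in> C \<Longrightarrow> x + y \<in> C"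
    and "\<And>a x. x \<in> C \<Longrightarrow> a \<cdot>\<^sub>v x \<in> C"
  shows "linear_code n C"
proof -
  interpret V: vec_space "TYPE('a)" n .
  show ?thesis
    unfolding linear_code_def
    unfolding subspace_def submodule_def
    using assms V.vectorspace_axioms V.module_axioms
    by (auto simp: module_vec_simps class_ring_simps)
qed

lemma mult_mat_vec_zero: "A \<in> carrier_mat m k \<Longrightarrow> A *\<^sub>v 0\<^sub>v k = (0\<^sub>v m :: 'a::semiring_0 vec)"
  by (intro eq_vecI) auto

lemma linear_code_image:
  fixes A :: "'a::field mat"
  assumes "A \<in> carrier_mat n k"
  shows "linear_code n ((*\<^sub>v) A ` carrier_vec k)"
  apply (rule linear_codeI)
  subgoal using assms by auto
  subgoal using mult_mat_vec_zero[OF assms] by (metis imageI zero_carrier_vec)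
  subgoal using mult_add_distrib_mat_vec[OF assms] by (auto) (metis add_carrier_vec imageI)
  subgoal using mult_mat_vec[OF assms] by (auto) (metis smult_carrier_vec imageI)
  done

lemma code_dim_image:
  fixes A L :: "'a::{field,finite} mat"
  assumes "A \<in> carrier_mat n k" "L \<in> carrier_mat k n" "L * A = 1\<^sub>m k"
  shows "code_dim n ((*\<^sub>v) A ` carrier_vec k) = k"
proof (rule code_dim_eqI[OF linear_code_image[OF assms(1)]])
  have "L *\<^sub>v (A *\<^sub>v x) = x" if "x \<in> carrier_vec k" for x
    using assms that by (metis assoc_mult_mat_vec one_mult_mat_vec)
  then have "inj_on ((*\<^sub>v) A) (carrier_vec k)" by (metis inj_onI)
  then show "card ((*\<^sub>v) A ` carrier_vec k) = CARD('a) ^ k"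
    by (simp add: card_image card_carrier_vec)
qed

lemma linear_code_mat_kernel:
  fixes H :: "'a::field mat"
  assumes "H \<in> carrier_mat m n"
  shows "linear_code n (mat_kernel H)"
  apply (rule linear_codeI; (unfold mat_kernel[OF assms])?)
  subgoal by auto
  subgoal using mult_mat_vec_zero[OF assms] by auto
  subgoal using mult_add_distrib_mat_vec[OF assms] by auto
  subgoal using mult_mat_vec[OF assms] by auto
  done

text \<open>The right inverse splits every x uniquely as z + R y with z in the kernel and y = H x;
  counting both sides gives the dimension.\<close>

lemma code_dim_mat_kernel:
  fixes H R :: "'a::{field,finite} mat"
  assumes H: "H \<in> carrier_mat m n" and R: "R \<in> carrier_mat n m" and HR: "H * R = 1\<^sub>m m"
  shows "code_dim n (mat_kernel H) + m = n"
proof -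
  have HRx: "H *\<^sub>v (R *\<^sub>v y) = y" if "y \<in> carrier_vec m" for y
    using assms that by (metis assoc_mult_mat_vec one_mult_mat_vec)
  let ?K = "mat_kernel H"
  have "bij_betw (\<lambda>(z, y). z + R *\<^sub>v y) (?K \<times> carrier_vec m) (carrier_vec n)"
  proof (rule bij_betwI[where g = "\<lambda>x. (x - R *\<^sub>v (H *\<^sub>v x), H *\<^sub>v x)"])
    show "(\<lambda>(z, y). z + R *\<^sub>v y) \<in> ?K \<times> carrier_vec m \<rightarrow> carrier_vec n"
      using H R by (auto simp: mat_kernel[OF H])
    show "(\<lambda>x. (x - R *\<^sub>v (H *\<^sub>v x), H *\<^sub>v x)) \<in> carrier_vec n \<rightarrow> ?K \<times> carrier_vec m"
    proof
      fix x :: "'a vec" assume x: "x \<in> carrier_vec n"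
      have "H *\<^sub>v (x - R *\<^sub>v (H *\<^sub>v x)) = H *\<^sub>v x - H *\<^sub>v (R *\<^sub>v (H *\<^sub>v x))"
        by (rule mult_minus_distrib_mat_vec[OF H x]) (use R H x in auto)
      also have "\<dots> = 0\<^sub>v m" using HRx[of "H *\<^sub>v x"] H x by (auto intro!: eq_vecI)
      finally show "(x - R *\<^sub>v (H *\<^sub>v x), H *\<^sub>v x) \<in> ?K \<times> carrier_vec m"
        using x H R by (auto simp: mat_kernel[OF H])
    qed
  next
    fix p :: "'a vec \<times> 'a vec" assume "p \<in> ?K \<times> carrier_vec m"
    then obtain z y where p: "p = (z, y)" "z \<in> carrier_vec n" "H *\<^sub>v z = 0\<^sub>v m" "y \<in> carrier_vec m"
      by (auto simp: mat_kernel[OF H])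
    have Ry: "R *\<^sub>v y \<in> carrier_vec n" using R p by auto
    have "H *\<^sub>v (z + R *\<^sub>v y) = y"
      using mult_add_distrib_mat_vec[OF H p(2) Ry] HRx[OF p(4)] p by auto
    moreover have "z + R *\<^sub>v y - R *\<^sub>v y = z" using p R by (auto intro!: eq_vecI)
    ultimately show "(\<lambda>x. (x - R *\<^sub>v (H *\<^sub>v x), H *\<^sub>v x)) ((\<lambda>(z, y). z + R *\<^sub>v y) p) = p"
      by (simp add: p)
  next
    fix x :: "'a vec" assume x: "x \<in> carrier_vec n"
    have "R *\<^sub>v (H *\<^sub>v x) \<in> carrier_vec n" using R H x by auto
    then show "(\<lambda>(z, y). z + R *\<^sub>v y) ((\<lambda>x. (x - R *\<^sub>v (H *\<^sub>v x), H *\<^sub>v x)) x) = x"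
      using x R by (auto intro!: eq_vecI)
  qed
  then have "card (?K \<times> (carrier_vec m :: 'a vec set)) = card (carrier_vec n :: 'a vec set)"
    by (rule bij_betw_same_card)
  then have "CARD('a) ^ (code_dim n ?K + m) = CARD('a) ^ n"
    using card_linear_code[OF linear_code_mat_kernel[OF H]]
    by (simp add: card_cartesian_product card_carrier_vec power_add)
  moreover have "1 < CARD('a)" using card_mono[of UNIV "{0::'a,1}"] by simp
  ultimately show ?thesis by simp
qed

lemma transpose_mult_mem_dual_code:
  fixes H :: "'a::field mat"
  assumes "H \<in> carrier_mat m n" "y \<in> carrier_vec m"
  shows "H\<^sup>T *\<^sub>v y \<in> dual_code n (mat_kernel H)"
proof -
  have "x \<bullet> (H\<^sup>T *\<^sub>v y) = 0" if x: "x \<in> carrier_vec n" "H *\<^sub>v x = 0\<^sub>v m" for x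
  proof -
    have "x \<bullet> (H\<^sup>T *\<^sub>v y) = (H\<^sup>T *\<^sub>v y) \<bullet> x" using assms x
      by (intro comm_scalar_prod[of _ n]) auto
    also have "\<dots> = y \<bullet> (H *\<^sub>v x)" using assms x transpose_vec_mult_scalar by blast
    finally show ?thesis using assms x by simp
  qed
  then show ?thesis using assms by (auto simp: dual_code_def mat_kernel[OF assms(1)])
qed

text \<open>A vector z orthogonal to the kernel only sees the component R H x of x. Hence z and
  \<open>H\<^sup>T *\<^sub>v (R\<^sup>T *\<^sub>v z)\<close> have the same scalar product with every
  x, in particular with unit vectors.\<close>

lemma dual_code_mat_kernel:
  fixes H R :: "'a::field mat"
  assumes H: "H \<in> carrier_mat m n" and R: "R \<in> carrier_mat n m" and HR: "H * R = 1\<^sub>m m"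
  shows "dual_code n (mat_kernel H) = (*\<^sub>v) H\<^sup>T ` carrier_vec m"
proof (intro equalityI subsetI)
  fix z assume "z \<in> dual_code n (mat_kernel H)"
  then have z: "z \<in> carrier_vec n" and orth: "\<And>x. x \<in> mat_kernel H \<Longrightarrow> x \<bullet> z = 0"
    by (auto simp: dual_code_def)
  have RTz: "R\<^sup>T *\<^sub>v z \<in> carrier_vec m" using R z by auto
  have eq: "z \<bullet> x = (H\<^sup>T *\<^sub>v (R\<^sup>T *\<^sub>v z)) \<bullet> x" if x: "x \<in> carrier_vec n" for x
  proof -
    let ?p = "R *\<^sub>v (H *\<^sub>v x)"
    have p: "?p \<in> carrier_vec n" and Hx: "H *\<^sub>v x \<in> carrier_vec m" using R H x by auto
    have "H *\<^sub>v ?p = H *\<^sub>v x" using HR H R Hx by (metis assoc_mult_mat_vec one_mult_mat_vec)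
    then have "H *\<^sub>v (x - ?p) = 0\<^sub>v m"
      using mult_minus_distrib_mat_vec[OF H x p] Hx by (auto intro!: eq_vecI)
    then have "(x - ?p) \<bullet> z = 0" using x p by (intro orth) (auto simp: mat_kernel[OF H])
    then have "x \<bullet> z = ?p \<bullet> z" using minus_scalar_prod_distrib[OF x p z] by simp
    then have "z \<bullet> x = z \<bullet> ?p" using comm_scalar_prod[of _ n] x p z by metis
    also have "\<dots> = (R\<^sup>T *\<^sub>v z) \<bullet> (H *\<^sub>v x)" using transpose_vec_mult_scalar[OF R Hx z] by simp
    also have "\<dots> = (H\<^sup>T *\<^sub>v (R\<^sup>T *\<^sub>v z)) \<bullet> x" using transpose_vec_mult_scalar[OF H x RTz] by simp
    finally show ?thesis .
  qed
  have "z = H\<^sup>T *\<^sub>v (R\<^sup>T *\<^sub>v z)"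
  proof (rule eq_vecI)
    fix i assume "i < dim_vec (H\<^sup>T *\<^sub>v (R\<^sup>T *\<^sub>v z))"
    then have i: "i < n" using H by simp
    show "z $ i = (H\<^sup>T *\<^sub>v (R\<^sup>T *\<^sub>v z)) $ i"
      using eq[of "unit_vec n i"] i z H by (simp add: scalar_prod_right_unit)
  qed (use z H in auto)
  then show "z \<in> (*\<^sub>v) H\<^sup>T ` carrier_vec m" using RTz by blast
qed (use transpose_mult_mem_dual_code[OF H] in auto)

lemma rank_eq_code_dim:
  fixes A :: "'a::field mat"
  assumes "A \<in> carrier_mat m k"
  shows "vec_space.rank m A = code_dim m ((*\<^sub>v) A ` carrier_vec k)"
proof -
  interpret V: vec_space "TYPE('a)" m .
  have "V.span (set (cols A)) = (*\<^sub>v) A ` carrier_vec k"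
    using V.col_space_eq[OF assms] assms unfolding V.col_space_def by auto
  then show ?thesis unfolding V.rank_def code_dim_def by simp
qed

text \<open>By the pigeonhole principle q^k vectors cannot map injectively into q^m; the difference
  of a collision is the witness.\<close>

lemma exists_nonzero_kernel_vec:
  fixes A :: "'a::{field,finite} mat"
  assumes A: "A \<in> carrier_mat m k" and "m < k"
  obtains y where "y \<in> carrier_vec k" "y \<noteq> 0\<^sub>v k" "A *\<^sub>v y = 0\<^sub>v m"
proof -
  have q1: "1 < CARD('a)" using card_mono[of UNIV "{0::'a,1}"] by simp
  have "\<not> inj_on ((*\<^sub>v) A) (carrier_vec k)"
  proof
    assume inj: "inj_on ((*\<^sub>v) A) (carrier_vec k)"
    have "(*\<^sub>v) A ` carrier_vec k \<subseteq> carrier_vec m" using A by auto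
    then have "card (carrier_vec k :: 'a vec set) \<le> card (carrier_vec m :: 'a vec set)"
      by (intro card_inj_on_le[OF inj]) auto
    then show False using q1 assms(2) by (simp add: card_carrier_vec)
  qed
  then obtain y y' where y: "y \<in> carrier_vec k" "y' \<in> carrier_vec k" "y \<noteq> y'" "A *\<^sub>v y = A *\<^sub>v y'"
    by (auto simp: inj_on_def)
  have "y - y' \<noteq> 0\<^sub>v k"
  proof
    assume 0: "y - y' = 0\<^sub>v k"
    have "y $ j = y' $ j" if "j < k" for j
      using arg_cong[OF 0, of "\<lambda>v. v $ j"] that y by simp
    then show False using y by (auto intro: eq_vecI)
  qed
  moreover have "A *\<^sub>v (y - y') = 0\<^sub>v m"
    using mult_minus_distrib_mat_vec[OF A y(1,2)] y A by auto
  ultimately show ?thesis using that[of "y - y'"] y by auto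
qed

section \<open>Partially diagonal matrices and the intersection of a kernel with a dual\<close>

text \<open>The shape taken by the product of the two check matrices. If \<open>D\<close> has no
  zero among its first c values, then c is the rank and thus the number of entangled pairs.\<close>

definition partial_diag :: "nat \<Rightarrow> nat \<Rightarrow> (nat \<Rightarrow> 'a::zero) \<Rightarrow> 'a mat" where
  "partial_diag m c D = mat m m (\<lambda>(i, j). if i = j \<and> i < c then D i else 0)"

lemma partial_diag_carrier [simp]:
  "partial_diag m c D \<in> carrier_mat m m" "dim_row (partial_diag m c D) = m" "dim_col (partial_diag m c D) = m"
  by (simp_all add: partial_diag_def)

lemma partial_diag_transpose: "(partial_diag m c D)\<^sup>T = partial_diag m c D"
  by (auto simp: partial_diag_def intro!: eq_matI)

lemma partial_diag_mult_vec:
  fixes y :: "'a::semiring_0 vec"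
  assumes "y \<in> carrier_vec m" "i < m"
  shows "(partial_diag m c D *\<^sub>v y) $ i = (if i < c then D i * y $ i else 0)"
proof -
  have "(partial_diag m c D *\<^sub>v y) $ i = (\<Sum>j\<in>{0..<m}. (if i = j \<and> i < c then D i else 0) * y $ j)"
    using assms by (simp add: partial_diag_def scalar_prod_def)
  also have "\<dots> = (\<Sum>j\<in>{0..<m}. if j = i then (if i < c then D i * y $ i else 0) else 0)"
    by (intro sum.cong) auto
  also have "\<dots> = (if i < c then D i * y $ i else 0)"
    using assms(2) by simp
  finally show ?thesis .
qed

lemma partial_diag_mult_vec_eq_0_iff:
  fixes y :: "'a::idom vec"
  assumes "y \<in> carrier_vec m" "c \<le> m" "\<And>i. i < c \<Longrightarrow> D i \<noteq> 0"
  shows "partial_diag m c D *\<^sub>v y = 0\<^sub>v m \<longleftrightarrow> (\<forall>i<c. y $ i = 0)"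
proof
  assume 0: "partial_diag m c D *\<^sub>v y = 0\<^sub>v m"
  show "\<forall>i<c. y $ i = 0"
  proof (intro allI impI)
    fix i assume "i < c"
    then show "y $ i = 0"
      using arg_cong[OF 0, of "\<lambda>v. v $ i"] partial_diag_mult_vec[OF assms(1), of i c D] assms(2,3) by simp
  qed
next
  assume "\<forall>i<c. y $ i = 0"
  then show "partial_diag m c D *\<^sub>v y = 0\<^sub>v m"
    using partial_diag_mult_vec[OF assms(1), of _ c D] by (intro eq_vecI) (auto simp: partial_diag_def)
qed

text \<open>The inclusion of k coordinates starting at position a. With a = 0 it parametrizes the
  image of a \<open>partial_diag\<close> of rank c, with a = c its kernel; the transpose is a left
  inverse.\<close>

definition inject_coords :: "nat \<Rightarrow> nat \<Rightarrow> nat \<Rightarrow> 'a::zero_neq_one mat" where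
  "inject_coords m a k = mat m k (\<lambda>(i, j). if i = a + j then 1 else 0)"

lemma inject_coords_carrier [simp]:
  "inject_coords m a k \<in> carrier_mat m k" "dim_row (inject_coords m a k) = m" "dim_col (inject_coords m a k) = k"
  by (simp_all add: inject_coords_def)

lemma inject_coords_left_inverse:
  assumes "a + k \<le> m"
  shows "(inject_coords m a k)\<^sup>T * inject_coords m a k = (1\<^sub>m k :: 'a::semiring_1 mat)"
proof (rule eq_matI)
  fix i j assume "i < dim_row (1\<^sub>m k :: 'a mat)" "j < dim_col (1\<^sub>m k :: 'a mat)"
  then have ij: "i < k" "j < k" by auto
  have "((inject_coords m a k)\<^sup>T * inject_coords m a k) $$ (i, j) =
      (\<Sum>l\<in>{0..<m}. (if l = a + i then 1 else 0) * (if l = a + j then 1 else 0))"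
    using ij by (simp add: inject_coords_def scalar_prod_def)
  also have "\<dots> = (\<Sum>l\<in>{0..<m}. if l = a + i then (if i = j then 1 else 0) else (0::'a))"
    by (intro sum.cong) auto
  finally show "((inject_coords m a k)\<^sup>T * inject_coords m a k) $$ (i, j) = (1\<^sub>m k :: 'a mat) $$ (i, j)"
    using ij assms by simp
qed (auto simp: inject_coords_def)

lemma inject_coords_mult_vec:
  fixes z :: "'a::semiring_1 vec"
  assumes "z \<in> carrier_vec k" "i < m"
  shows "(inject_coords m a k *\<^sub>v z) $ i = (if a \<le> i \<and> i < a + k then z $ (i - a) else 0)"
proof -
  have "(inject_coords m a k *\<^sub>v z) $ i =
      (\<Sum>j\<in>{0..<k}. (if i = a + j then 1 else 0) * z $ j)"
    using assms by (simp add: inject_coords_def scalar_prod_def)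
  also have "\<dots> = (\<Sum>j\<in>{0..<k}. if j = i - a then (if a \<le> i then z $ (i - a) else 0) else 0)"
    by (intro sum.cong) auto
  also have "\<dots> = (if a \<le> i \<and> i < a + k then z $ (i - a) else 0)"
    by auto
  finally show ?thesis .
qed

lemma image_inject_coords:
  assumes "a + k \<le> m"
  shows "(*\<^sub>v) (inject_coords m a k) ` carrier_vec k =
     {y \<in> carrier_vec m. \<forall>i<m. \<not> (a \<le> i \<and> i < a + k) \<longrightarrow> y $ i = (0::'a::semiring_1)}"
proof (intro equalityI subsetI)
  fix y :: "'a vec" assume "y \<in> {y \<in> carrier_vec m. \<forall>i<m. \<not> (a \<le> i \<and> i < a + k) \<longrightarrow> y $ i = 0}"
  then have y: "y \<in> carrier_vec m" "\<And>i. i < m \<Longrightarrow> \<not> (a \<le> i \<and> i < a + k) \<Longrightarrow> y $ i = 0" by auto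
  have "y = inject_coords m a k *\<^sub>v vec k (\<lambda>j. y $ (a + j))"
    using y by (intro eq_vecI) (auto simp: inject_coords_mult_vec simp del: index_mult_mat_vec)
  then show "y \<in> (*\<^sub>v) (inject_coords m a k) ` carrier_vec k" by auto
qed (auto simp: inject_coords_mult_vec simp del: index_mult_mat_vec
    intro: mult_mat_vec_carrier[OF inject_coords_carrier(1)])

lemma rank_partial_diag:
  fixes D :: "nat \<Rightarrow> 'a::{field,finite}"
  assumes "c \<le> m" "\<And>i. i < c \<Longrightarrow> D i \<noteq> 0"
  shows "vec_space.rank m (partial_diag m c D) = c"
proof -
  have "(*\<^sub>v) (partial_diag m c D) ` carrier_vec m = {y \<in> carrier_vec m. \<forall>i<m. \<not> (0 \<le> i \<and> i < 0 + c) \<longrightarrow> y $ i = 0}"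
  proof (intro equalityI subsetI)
    fix y :: "'a vec" assume "y \<in> {y \<in> carrier_vec m. \<forall>i<m. \<not> (0 \<le> i \<and> i < 0 + c) \<longrightarrow> y $ i = 0}"
    then have "y = partial_diag m c D *\<^sub>v vec m (\<lambda>i. y $ i / D i)"
      using assms by (intro eq_vecI) (auto simp: partial_diag_mult_vec simp del: index_mult_mat_vec)
    then show "y \<in> (*\<^sub>v) (partial_diag m c D) ` carrier_vec m" by auto
  qed (auto simp: partial_diag_mult_vec simp del: index_mult_mat_vec
    intro: mult_mat_vec_carrier[OF partial_diag_carrier(1)])
  also have "\<dots> = (*\<^sub>v) (inject_coords m 0 c) ` carrier_vec c"
    using assms(1) by (subst image_inject_coords) auto
  finally have "vec_space.rank m (partial_diag m c D) = code_dim m ((*\<^sub>v) (inject_coords m 0 c :: 'a mat) ` carrier_vec c)"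
    by (simp add: rank_eq_code_dim[of _ m m])
  also have "\<dots> = c"
    using assms(1) inject_coords_left_inverse[of 0 c m, where ?'a = 'a]
    by (intro code_dim_image[where L = "(inject_coords m 0 c)\<^sup>T"]) auto
  finally show ?thesis .
qed

lemma partial_diag_rank_factorization:
  fixes D :: "nat \<Rightarrow> 'a::comm_ring_1"
  assumes "c \<le> m"
  shows "- partial_diag m c D =
    mat m c (\<lambda>(i, j). if i = j then - D i else 0) * (inject_coords m 0 c)\<^sup>T"
proof (rule eq_matI)
  let ?F = "mat m c (\<lambda>(i, j). if i = j then - D i else 0)"
  fix i j assume "i < dim_row (?F * (inject_coords m 0 c)\<^sup>T)" "j < dim_col (?F * (inject_coords m 0 c)\<^sup>T)"
  then have ij: "i < m" "j < m" by (auto simp: inject_coords_def)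
  have "(?F * (inject_coords m 0 c)\<^sup>T) $$ (i, j) =
      (\<Sum>l\<in>{0..<c}. (if i = l then - D i else 0) * (if j = l then 1 else 0))"
    using ij by (simp add: inject_coords_def scalar_prod_def)
  also have "\<dots> = (\<Sum>l\<in>{0..<c}. if l = i then (if i = j then - D i else 0) else 0)"
    by (intro sum.cong) auto
  also have "\<dots> = (- partial_diag m c D) $$ (i, j)"
    using ij by (auto simp: partial_diag_def)
  finally show "(- partial_diag m c D) $$ (i, j) = (?F * (inject_coords m 0 c)\<^sup>T) $$ (i, j)" ..
qed (auto simp: partial_diag_def inject_coords_def)

text \<open>A vector of the dual has the form \<open>A\<^sup>T *\<^sub>v y\<close>, with y unique
  because \<open>R\<^sup>T\<close> is a left inverse of \<open>A\<^sup>T\<close>. It lies in the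
  kernel of B exactly if the first c coordinates of y vanish, which leaves m - c free
  coordinates.\<close>

lemma code_dim_dual_inter_kernel:
  fixes A B R :: "'a::{field,finite} mat"
  assumes A: "A \<in> carrier_mat m n" and B: "B \<in> carrier_mat m n"
    and R: "R \<in> carrier_mat n m" "A * R = 1\<^sub>m m"
    and BA: "B * A\<^sup>T = partial_diag m c D" and D: "c \<le> m" "\<And>i. i < c \<Longrightarrow> D i \<noteq> 0"
  shows "code_dim n (dual_code n (mat_kernel A) \<inter> mat_kernel B) = m - c"
proof -
  let ?E = "inject_coords m c (m - c) :: 'a mat"
  have E: "?E \<in> carrier_mat m (m - c)" by simp
  have AE: "A\<^sup>T * ?E \<in> carrier_mat n (m - c)" using A by auto
  have BAy: "B *\<^sub>v (A\<^sup>T *\<^sub>v y) = partial_diag m c D *\<^sub>v y" if "y \<in> carrier_vec m" for y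
    using A B that BA by (metis assoc_mult_mat_vec transpose_carrier_mat)
  have "dual_code n (mat_kernel A) \<inter> mat_kernel B = (*\<^sub>v) A\<^sup>T ` {y \<in> carrier_vec m. partial_diag m c D *\<^sub>v y = 0\<^sub>v m}"
    using A BAy unfolding dual_code_mat_kernel[OF A R] mat_kernel[OF B] by auto
  also have "{y \<in> carrier_vec m. partial_diag m c D *\<^sub>v y = 0\<^sub>v m} = (*\<^sub>v) ?E ` carrier_vec (m - c)"
    using D by (subst image_inject_coords) (auto simp: partial_diag_mult_vec_eq_0_iff)
  also have "(*\<^sub>v) A\<^sup>T ` (*\<^sub>v) ?E ` carrier_vec (m - c) = (*\<^sub>v) (A\<^sup>T * ?E) ` carrier_vec (m - c)"
    unfolding image_image using A E by (intro image_cong refl) (metis assoc_mult_mat_vec transpose_carrier_mat)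
  also have "code_dim n \<dots> = m - c"
  proof (rule code_dim_image[OF AE])
    show L: "?E\<^sup>T * R\<^sup>T \<in> carrier_mat (m - c) n" using R(1) by (intro mult_carrier_mat[of _ _ m]) auto
    have RA: "R\<^sup>T * A\<^sup>T = 1\<^sub>m m" using R A by (metis transpose_mult transpose_one)
    have "?E\<^sup>T * R\<^sup>T * (A\<^sup>T * ?E) = ?E\<^sup>T * (R\<^sup>T * (A\<^sup>T * ?E))"
      using R AE E by (intro assoc_mult_mat) auto
    also have "R\<^sup>T * (A\<^sup>T * ?E) = R\<^sup>T * A\<^sup>T * ?E"
      using R A E by (intro assoc_mult_mat[symmetric]) auto
    also have "\<dots> = ?E" using RA E by simp
    finally show "?E\<^sup>T * R\<^sup>T * (A\<^sup>T * ?E) = 1\<^sub>m (m - c)"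
      using D(1) inject_coords_left_inverse[of c "m - c" m, where ?'a = 'a] by simp
  qed
  finally show ?thesis .
qed

section \<open>Recovery of an erased qudit\<close>

lemma psd_on_cong:
  assumes "\<And>a b. a \<in> A \<Longrightarrow> b \<in> A \<Longrightarrow> M a b = N a b"
  shows "psd_on A M \<longleftrightarrow> psd_on A N"
proof -
  have "(\<Sum>a\<in>A. \<Sum>b\<in>A. cnj (v a) * M a b * v b) = (\<Sum>a\<in>A. \<Sum>b\<in>A. cnj (v a) * N a b * v b)" for v
    by (intro sum.cong refl) (simp add: assms)
  then show ?thesis unfolding psd_on_def by simp
qed

text \<open>The quadratic form of the new operator at v is that of M at the push-forward of v, which
  sums v over the fibres of \<tau> in T. Thus \<tau> may merge indices, as the maps of the recovery
  channel do.\<close>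

lemma psd_on_pullback:
  assumes fin: "finite A" "finite B" and T: "T \<subseteq> A" "\<tau> ` T \<subseteq> B" and M: "psd_on B M"
  shows "psd_on A (\<lambda>a b. if a \<in> T \<and> b \<in> T then M (\<tau> a) (\<tau> b) else 0)"
  unfolding psd_on_def
proof
  fix v :: "'a \<Rightarrow> complex"
  have finT: "finite T" using T fin finite_subset by blast
  define w where "w c = (\<Sum>a | a \<in> T \<and> \<tau> a = c. v a)" for c
  have "(\<Sum>c\<in>B. \<Sum>d\<in>B. cnj (w c) * M c d * w d) =
      (\<Sum>c\<in>B. \<Sum>d\<in>B. \<Sum>a | a \<in> T \<and> \<tau> a = c. \<Sum>b | b \<in> T \<and> \<tau> b = d. cnj (v a) * M (\<tau> a) (\<tau> b) * v b)"
  proof (intro sum.cong refl)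
    fix c d
    have "cnj (w c) * M c d * w d =
        (\<Sum>a | a \<in> T \<and> \<tau> a = c. cnj (v a) * M c d) * (\<Sum>b | b \<in> T \<and> \<tau> b = d. v b)"
      by (simp add: w_def sum_distrib_right)
    also have "\<dots> = (\<Sum>a | a \<in> T \<and> \<tau> a = c. \<Sum>b | b \<in> T \<and> \<tau> b = d. cnj (v a) * M (\<tau> a) (\<tau> b) * v b)"
      unfolding sum_product by (intro sum.cong refl) auto
    finally show "cnj (w c) * M c d * w d = \<dots>" .
  qed
  also have "\<dots> = (\<Sum>c\<in>B. \<Sum>a | a \<in> T \<and> \<tau> a = c. \<Sum>d\<in>B. \<Sum>b | b \<in> T \<and> \<tau> b = d. cnj (v a) * M (\<tau> a) (\<tau> b) * v b)"
    by (intro sum.cong refl sum.swap)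
  also have "\<dots> = (\<Sum>a\<in>T. \<Sum>b\<in>T. cnj (v a) * M (\<tau> a) (\<tau> b) * v b)"
    by (simp only: sum.group[OF finT fin(2) T(2)])
  also have "\<dots> = (\<Sum>a\<in>A. \<Sum>b\<in>A. cnj (v a) * (if a \<in> T \<and> b \<in> T then M (\<tau> a) (\<tau> b) else 0) * v b)"
    by (rule sum.mono_neutral_cong_left[OF fin(1) T(1)])
       (auto intro!: sum.mono_neutral_cong_left fin(1) T(1) sum.neutral)
  finally show "let z = \<Sum>a\<in>A. \<Sum>b\<in>A. cnj (v a) * (if a \<in> T \<and> b \<in> T then M (\<tau> a) (\<tau> b) else 0) * v b
      in Im z = 0 \<and> Re z \<ge> 0"
    using M unfolding psd_on_def Let_def by metis
qed

lemma psd_on_sum: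
  fixes A :: "'b set" and M :: "'k \<Rightarrow> 'b oper"
  assumes "\<And>k. k \<in> K \<Longrightarrow> psd_on A (M k)"
  shows "psd_on A (\<lambda>a b. \<Sum>k\<in>K. M k a b)"
  unfolding psd_on_def Let_def
proof
  fix v :: "'b \<Rightarrow> complex"
  have "(\<Sum>a\<in>A. \<Sum>b\<in>A. cnj (v a) * (\<Sum>k\<in>K. M k a b) * v b) =
      (\<Sum>a\<in>A. \<Sum>b\<in>A. \<Sum>k\<in>K. cnj (v a) * M k a b * v b)"
    by (simp add: sum_distrib_left sum_distrib_right)
  also have "\<dots> = (\<Sum>k\<in>K. \<Sum>a\<in>A. \<Sum>b\<in>A. cnj (v a) * M k a b * v b)"
    by (simp add: sum.swap[of _ K A])
  finally show "Im (\<Sum>a\<in>A. \<Sum>b\<in>A. cnj (v a) * (\<Sum>k\<in>K. M k a b) * v b) = 0 \<and>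
      0 \<le> Re (\<Sum>a\<in>A. \<Sum>b\<in>A. cnj (v a) * (\<Sum>k\<in>K. M k a b) * v b)"
    using assms unfolding psd_on_def Let_def by (simp add: sum_nonneg)
qed

lemma psd_on_divide_of_nat:
  fixes A :: "'b set"
  assumes "psd_on A M"
  shows "psd_on A (\<lambda>a b. M a b / of_nat m)"
  unfolding psd_on_def Let_def
proof
  fix v :: "'b \<Rightarrow> complex"
  have "(\<Sum>a\<in>A. \<Sum>b\<in>A. cnj (v a) * (M a b / of_nat m) * v b) =
      (\<Sum>a\<in>A. \<Sum>b\<in>A. cnj (v a) * M a b * v b) / of_nat m"
    by (simp add: sum_divide_distrib)
  then show "Im (\<Sum>a\<in>A. \<Sum>b\<in>A. cnj (v a) * (M a b / of_nat m) * v b) = 0 \<and>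
      0 \<le> Re (\<Sum>a\<in>A. \<Sum>b\<in>A. cnj (v a) * (M a b / of_nat m) * v b)"
    using assms unfolding psd_on_def Let_def by simp
qed

lemma scalar_prod_restrict_vec:
  fixes h :: "'a::semiring_0 vec"
  assumes "vsupp h \<subseteq> S" "dim_vec h = dim_vec x"
  shows "h \<bullet> restrict_vec S x = h \<bullet> x"
  unfolding scalar_prod_def restrict_vec_def
  using assms by (auto simp: vsupp_def intro!: sum.cong)

lemma set_coord_set_coord [simp]: "set_coord (set_coord x i t) i z = set_coord x i z"
  by (auto simp: set_coord_def)

section \<open>The recovery channel\<close>

text \<open>The pair (\<open>h\<close>, \<open>f\<close>) is the action of an X-type stabilizer on
  the transmitted and receiver registers, and (\<open>hz\<close>, \<open>g\<close>) that of a Z-type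
  one. The assumption \<open>commute\<close> makes the Z-type check invariant under the X-type
  shift.\<close>

locale qudit_recovery =
  fixes n c i :: nat and S :: "nat set" and h hz f g :: "'a::{field,finite} vec"
  assumes carriers: "h \<in> carrier_vec n" "hz \<in> carrier_vec n" "f \<in> carrier_vec c" "g \<in> carrier_vec c"
    and supports: "vsupp h \<subseteq> S" "vsupp hz \<subseteq> S"
    and i: "i < n" "i \<in> S" "h $ i \<noteq> 0" "hz $ i \<noteq> 0"
    and commute: "hz \<bullet> h + g \<bullet> f = 0"
begin

definition check :: "'a vec \<times> 'a vec \<Rightarrow> 'a" where
  "check \<omega> = hz \<bullet> fst \<omega> + g \<bullet> snd \<omega>"

text \<open>The multiple of (\<open>h\<close>, \<open>f\<close>) is chosen so that position i
  receives the symbol t. States fixed by the X-type stabilizers have the same amplitude before and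
  after.\<close>

definition shift :: "'a \<Rightarrow> 'a vec \<times> 'a vec \<Rightarrow> 'a vec \<times> 'a vec" where
  "shift t \<omega> = (fst \<omega> - ((fst \<omega> $ i - t) / h $ i) \<cdot>\<^sub>v h, snd \<omega> - ((fst \<omega> $ i - t) / h $ i) \<cdot>\<^sub>v f)"

definition put :: "'a \<Rightarrow> 'a vec \<times> 'a vec \<Rightarrow> 'a vec \<times> 'a vec" where
  "put z \<omega> = (set_coord (fst \<omega>) i z, snd \<omega>)"

text \<open>
  The channel traces out position \<open>i\<close> (summation over \<open>z\<close>) and measures the symbol \<open>t\<close> that the
  vanishing of \<open>check\<close> prescribes there. Since the stabilizer moves \<open>t\<close> to any other symbol, each
  outcome can be sent to the uniform superposition of the shifted basis states, which explains the
  factor \<open>1/q\<close>.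
\<close>

definition recover :: "('a vec \<times> 'a vec) oper \<Rightarrow> ('a vec \<times> 'a vec) oper" where
  "recover M = (\<lambda>\<alpha> \<beta>. if check \<alpha> = 0 \<and> check \<beta> = 0
     then (\<Sum>z\<in>UNIV. \<Sum>t\<in>UNIV. M (put z (shift t \<alpha>)) (put z (shift t \<beta>))) / of_nat CARD('a) else 0)"

lemma put_basis [simp]: "\<omega> \<in> basis_idx n c \<Longrightarrow> put z \<omega> \<in> basis_idx n c"
  by (auto simp: put_def basis_idx_def set_coord_def)

lemma shift_basis [simp]: "\<omega> \<in> basis_idx n c \<Longrightarrow> shift t \<omega> \<in> basis_idx n c"
  using carriers by (auto simp: shift_def basis_idx_def)

lemma local_idx_basis: "\<omega> \<in> local_idx n c S \<Longrightarrow> \<omega> \<in> basis_idx n c"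
  by (auto simp: local_idx_def basis_idx_def)

lemma put_local [simp]: "\<omega> \<in> local_idx n c S \<Longrightarrow> put z \<omega> \<in> local_idx n c S"
  using i by (auto simp: put_def local_idx_def set_coord_def vsupp_def split: if_splits)

lemma shift_local [simp]: "\<omega> \<in> local_idx n c S \<Longrightarrow> shift t \<omega> \<in> local_idx n c S"
  using carriers supports by (force simp: shift_def local_idx_def vsupp_def)

lemma finite_local_idx: "finite (local_idx n c S :: ('a vec \<times> 'a vec) set)"
  by (rule finite_subset[of _ "carrier_vec n \<times> carrier_vec c"]) (auto simp: local_idx_def)

lemma fst_shift_i [simp]: "\<omega> \<in> basis_idx n c \<Longrightarrow> fst (shift t \<omega>) $ i = t"
  using carriers i by (auto simp: shift_def basis_idx_def)

lemma fst_put_i [simp]: "\<omega> \<in> basis_idx n c \<Longrightarrow> fst (put z \<omega>) $ i = z"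
  using carriers i by (auto simp: put_def basis_idx_def set_coord_def)

lemma put_put [simp]: "put z (put z' \<omega>) = put z \<omega>"
  by (auto simp: put_def set_coord_def)

lemma put_same: "\<omega> \<in> basis_idx n c \<Longrightarrow> z = fst \<omega> $ i \<Longrightarrow> put z \<omega> = \<omega>"
  by (auto simp: put_def basis_idx_def set_coord_def)

lemma shift_shift [simp]: "\<omega> \<in> basis_idx n c \<Longrightarrow> shift s (shift t \<omega>) = shift s \<omega>"
  using carriers fst_shift_i[of \<omega> t]
  by (auto simp: shift_def basis_idx_def diff_divide_distrib algebra_simps intro!: eq_vecI)

lemma shift_same: "\<omega> \<in> basis_idx n c \<Longrightarrow> t = fst \<omega> $ i \<Longrightarrow> shift t \<omega> = \<omega>"
  using carriers by (auto simp: shift_def basis_idx_def intro!: eq_vecI)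

lemma check_shift [simp]:
  assumes "\<omega> \<in> basis_idx n c"
  shows "check (shift t \<omega>) = check \<omega>"
proof -
  obtain x y where \<omega>: "\<omega> = (x, y)" "x \<in> carrier_vec n" "y \<in> carrier_vec c"
    using assms by (auto simp: basis_idx_def)
  let ?a = "(x $ i - t) / h $ i"
  have "check (shift t \<omega>) = hz \<bullet> x - ?a * (hz \<bullet> h) + (g \<bullet> y - ?a * (g \<bullet> f))"
    using \<omega> carriers by (simp add: check_def shift_def scalar_prod_minus_distrib[of _ n] scalar_prod_minus_distrib[of _ c])
  also have "\<dots> = check \<omega> - ?a * (hz \<bullet> h + g \<bullet> f)"
    unfolding check_def \<omega>(1) fst_conv snd_conv by (simp only: right_diff_distrib distrib_left) simp
  finally show ?thesis using commute by simp
qed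

text \<open>As \<open>hz $ i\<close> is nonzero, exactly one symbol at position i makes the check
  vanish; this is how the erased symbol is determined.\<close>

lemma check_put:
  assumes "\<omega> \<in> basis_idx n c"
  shows "check (put z \<omega>) = check \<omega> + hz $ i * (z - fst \<omega> $ i)"
proof -
  obtain x y where \<omega>: "\<omega> = (x, y)" "x \<in> carrier_vec n" "y \<in> carrier_vec c"
    using assms by (auto simp: basis_idx_def)
  have "set_coord x i z = x + (z - x $ i) \<cdot>\<^sub>v unit_vec n i"
    using \<omega> i by (auto simp: set_coord_def intro!: eq_vecI)
  then have "hz \<bullet> set_coord x i z = hz \<bullet> x + (z - x $ i) * hz $ i"
    using \<omega> carriers i by (simp add: scalar_prod_add_distrib[of _ n] scalar_prod_right_unit)
  then show ?thesis using \<omega> by (simp add: check_def put_def algebra_simps)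
qed

lemma linear_superop_recover: "linear_superop (local_idx n c S) recover"
  unfolding linear_superop_def recover_def
  by (auto simp: sum.distrib add_divide_distrib sum_distrib_left
    intro!: arg_cong[of _ _ "\<lambda>x. x / _"] sum.cong)

text \<open>Up to the factor 1/q the channel is a sum of pullbacks along
  \<open>put z (shift t _)\<close>, restricted to indices with vanishing check. The ancilla index is
  carried along unchanged, so positivity is inherited from M.\<close>

lemma completely_positive_recover: "completely_positive (local_idx n c S) recover"
  unfolding completely_positive_def
proof (intro allI impI)
  fix k :: nat and M :: "(('a vec \<times> 'a vec) \<times> nat) oper"
  let ?L = "local_idx n c S \<times> {..<k}"
  let ?T = "{(\<alpha>, j). \<alpha> \<in> local_idx n c S \<and> j < k \<and> check \<alpha> = 0}"
  assume M: "psd_on ?L M"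
  let ?\<tau> = "\<lambda>z t (\<alpha>, j::nat). (put z (shift t \<alpha>), j)"
  have "psd_on ?L (\<lambda>a b. (\<Sum>z\<in>UNIV. \<Sum>t\<in>UNIV. if a \<in> ?T \<and> b \<in> ?T
      then M (?\<tau> z t a) (?\<tau> z t b) else 0) / of_nat CARD('a))"
    by (intro psd_on_divide_of_nat psd_on_sum psd_on_pullback[OF _ _ _ _ M]) (auto simp: finite_local_idx)
  moreover have "(\<lambda>(a, i) (b, j). recover (\<lambda>a' b'. M (a', i) (b', j)) a b) x y =
      (\<Sum>z\<in>UNIV. \<Sum>t\<in>UNIV. if x \<in> ?T \<and> y \<in> ?T then M (?\<tau> z t x) (?\<tau> z t y) else 0) / of_nat CARD('a)"
    if "x \<in> ?L" "y \<in> ?L" for x y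
  proof (cases "x \<in> ?T \<and> y \<in> ?T")
    case True
    then show ?thesis by (cases x; cases y) (simp add: recover_def)
  next
    case False
    then have "(\<Sum>z\<in>UNIV. \<Sum>t\<in>UNIV. if x \<in> ?T \<and> y \<in> ?T then M (?\<tau> z t x) (?\<tau> z t y) else 0) = 0"
      by (intro sum.neutral ballI) (rule if_not_P)
    moreover have "\<not> (check (fst x) = 0 \<and> check (fst y) = 0)" using False that by auto
    ultimately show ?thesis by (cases x; cases y) (auto simp: recover_def)
  qed
  ultimately show "psd_on ?L (\<lambda>(a, i) (b, j). recover (\<lambda>a' b'. M (a', i) (b', j)) a b)"
    by (subst psd_on_cong) 
qed

text \<open>The triples (\<alpha>, z, t) with vanishing check at \<alpha> correspond to pairs
  (\<omega>, b), where \<omega> is \<open>put z (shift t \<alpha>)\<close> and b is the symbol of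
  \<alpha> at position i. The free b produces the factor q that cancels 1/q.\<close>

lemma trace_preserving_recover: "trace_preserving (local_idx n c S) recover"
  unfolding trace_preserving_def
proof
  fix M :: "('a vec \<times> 'a vec) oper"
  let ?L = "local_idx n c S :: ('a vec \<times> 'a vec) set"
  let ?K = "{\<alpha> \<in> ?L. check \<alpha> = 0}"
  \<comment> \<open>The unique symbol at position i that makes the check vanish; it recovers t from
    \<omega>.\<close>
  define fill where "fill \<omega> = fst \<omega> $ i - check \<omega> / hz $ i" for \<omega>
  have check_fill: "check (put (fill \<omega>) \<omega>) = 0" if "\<omega> \<in> ?L" for \<omega>
    using i local_idx_basis[OF that] by (simp add: check_put fill_def)
  have fill_put: "fill (put z (shift t \<omega>)) = t" if "\<omega> \<in> ?K" for \<omega> z t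
    using i local_idx_basis[of \<omega>] that by (simp add: check_put fill_def)
  have "(\<Sum>\<alpha>\<in>?L. recover M \<alpha> \<alpha>) =
      (\<Sum>\<alpha>\<in>?K. (\<Sum>z\<in>UNIV. \<Sum>t\<in>UNIV. M (put z (shift t \<alpha>)) (put z (shift t \<alpha>))) / of_nat CARD('a))"
    using finite_local_idx by (intro sum.mono_neutral_cong_right) (auto simp: recover_def)
  also have "\<dots> = (\<Sum>(\<alpha>, z, t)\<in>?K \<times> UNIV \<times> UNIV. M (put z (shift t \<alpha>)) (put z (shift t \<alpha>))) / of_nat CARD('a)"
    by (simp add: sum.cartesian_product sum_divide_distrib split_def)
  also have "(\<Sum>(\<alpha>, z, t)\<in>?K \<times> UNIV \<times> UNIV. M (put z (shift t \<alpha>)) (put z (shift t \<alpha>))) =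
      (\<Sum>(\<omega>, b)\<in>?L \<times> (UNIV :: 'a set). M \<omega> \<omega>)"
    by (rule sum.reindex_bij_witness[of _
          "\<lambda>(\<omega>, b). (shift b (put (fill \<omega>) \<omega>), fst \<omega> $ i, fill \<omega>)"
          "\<lambda>(\<alpha>, z, t). (put z (shift t \<alpha>), fst \<alpha> $ i)"])
       (auto simp: check_fill fill_put local_idx_basis shift_same put_same)
  also have "\<dots> / of_nat CARD('a) = (\<Sum>\<omega>\<in>?L. M \<omega> \<omega>)"
    by (simp add: sum.cartesian_product[symmetric] sum_distrib_left[symmetric])
  finally show "(\<Sum>\<alpha>\<in>?L. recover M \<alpha> \<alpha>) = (\<Sum>\<omega>\<in>?L. M \<omega> \<omega>)" .
qed

lemma quantum_channel_recover: "quantum_channel (local_idx n c S) recover"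
  unfolding quantum_channel_def
  using linear_superop_recover completely_positive_recover trace_preserving_recover by blast

text \<open>In the partial trace over position i only the symbol with vanishing check survives, and
  shift invariance gives it the original amplitude. Each of the q^2 pairs (z, t) then contributes
  the original entry, divided once by q for the erasure and once by q for the channel.\<close>

lemma recover_erased:
  fixes \<psi> :: "'a state"
  assumes inv: "\<And>\<omega> t. \<omega> \<in> basis_idx n c \<Longrightarrow> \<psi> (shift t \<omega>) = \<psi> \<omega>"
    and supp: "\<And>\<omega>. \<omega> \<in> basis_idx n c \<Longrightarrow> \<psi> \<omega> \<noteq> 0 \<Longrightarrow> check \<omega> = 0"
    and \<omega>: "\<omega> \<in> basis_idx n c" "\<omega>' \<in> basis_idx n c"
  shows "local_apply S recover (erase_qudit i (pure_density \<psi>)) \<omega> \<omega>' = pure_density \<psi> \<omega> \<omega>'"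
proof -
  let ?loc = "\<lambda>\<omega>. (restrict_vec S (fst \<omega>), snd \<omega>)"
  let ?ext = "\<lambda>\<omega> \<alpha>. (fst \<alpha> + restrict_vec (- S) (fst \<omega>), snd \<alpha>)"
  have check_loc: "check (?loc \<omega>) = check \<omega>" if "\<omega> \<in> basis_idx n c" for \<omega>
  proof -
    have "hz \<bullet> restrict_vec S (fst \<omega>) = hz \<bullet> fst \<omega>"
      using that carriers by (intro scalar_prod_restrict_vec[OF supports(2)]) (auto simp: basis_idx_def)
    then show ?thesis by (simp add: check_def)
  qed
  \<comment> \<open>Since \<open>h\<close> vanishes outside S and i lies in S, shifting and
    overwriting commute with splitting off the positions outside S.\<close>
  have ext_loc: "?ext \<omega> (put z (shift t (?loc \<omega>))) = put z (shift t \<omega>)" if "\<omega> \<in> basis_idx n c" for \<omega> z t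
  proof -
    have h0: "h $ j = 0" if "j < n" "j \<notin> S" for j
      using supports(1) that carriers by (auto simp: vsupp_def)
    show ?thesis using that i carriers h0
      by (auto simp: put_def shift_def basis_idx_def set_coord_def restrict_vec_def intro!: eq_vecI)
  qed
  have put_amp: "\<psi> (put t' (shift t \<omega>)) = (if t' = t then \<psi> \<omega> else 0)"
    if "\<omega> \<in> basis_idx n c" "check \<omega> = 0" for \<omega> t t'
  proof (cases "t' = t")
    case True
    then show ?thesis using that inv[of \<omega> t] by (simp add: put_same)
  next
    case False
    then have "check (put t' (shift t \<omega>)) \<noteq> 0" using that i by (simp add: check_put)
    then show ?thesis using supp[of "put t' (shift t \<omega>)"] that False by auto
  qed
  have erased: "erase_qudit i (pure_density \<psi>) (put z \<alpha>) (put z \<beta>) =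
      (\<Sum>t'\<in>UNIV. \<psi> (put t' \<alpha>) * cnj (\<psi> (put t' \<beta>))) / of_nat CARD('a)"
    if "\<alpha> \<in> basis_idx n c" "\<beta> \<in> basis_idx n c" for z \<alpha> \<beta>
    using fst_put_i[OF that(1), of z] fst_put_i[OF that(2), of z]
    by (simp add: erase_qudit_def pure_density_def put_def sum_divide_distrib)
  let ?\<rho> = "erase_qudit i (pure_density \<psi>)"
  have "local_apply S recover ?\<rho> \<omega> \<omega>' =
      recover (\<lambda>\<alpha> \<beta>. ?\<rho> (?ext \<omega> \<alpha>) (?ext \<omega>' \<beta>)) (?loc \<omega>) (?loc \<omega>')"
    by (simp add: local_apply_def split_def)
  also have "\<dots> = (if check \<omega> = 0 \<and> check \<omega>' = 0
     then (\<Sum>z\<in>UNIV. \<Sum>t\<in>UNIV. ?\<rho> (put z (shift t \<omega>)) (put z (shift t \<omega>'))) / of_nat CARD('a) else 0)"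
    unfolding recover_def check_loc[OF \<omega>(1)] check_loc[OF \<omega>(2)] ext_loc[OF \<omega>(1)] ext_loc[OF \<omega>(2)] ..
  also have "\<dots> = pure_density \<psi> \<omega> \<omega>'"
  proof (cases "check \<omega> = 0 \<and> check \<omega>' = 0")
    case True
    have "?\<rho> (put z (shift t \<omega>)) (put z (shift t \<omega>')) = pure_density \<psi> \<omega> \<omega>' / of_nat CARD('a)" for z t
    proof -
      have "?\<rho> (put z (shift t \<omega>)) (put z (shift t \<omega>')) =
          (\<Sum>t'\<in>UNIV. if t' = t then pure_density \<psi> \<omega> \<omega>' else 0) / of_nat CARD('a)"
        unfolding erased[OF shift_basis[OF \<omega>(1)] shift_basis[OF \<omega>(2)]]
        using True \<omega> by (intro arg_cong[of _ _ "\<lambda>x. x / _"] sum.cong refl) (simp add: put_amp pure_density_def)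
      then show ?thesis by simp
    qed
    then show ?thesis using True by simp
  next
    case False
    then have "\<psi> \<omega> = 0 \<or> \<psi> \<omega>' = 0" using supp[OF \<omega>(1)] supp[OF \<omega>(2)] by blast
    with False show ?thesis by (auto simp: pure_density_def)
  qed
  finally show ?thesis .
qed

end

section \<open>From stabilizers to local recovery\<close>

text \<open>The case v = 0 of the stabilizer condition, where all phases equal 1.\<close>

lemma stabilized_space_shift:
  fixes HX HZ FX FZ :: "'a::{field,finite} mat"
  assumes pp: "primepow CARD('a)"
    and \<psi>: "\<psi> \<in> stabilized_space n c HX HZ FX FZ"
    and dims: "HX \<in> carrier_mat m n" "HZ \<in> carrier_mat m' n" "FX \<in> carrier_mat m c" "FZ \<in> carrier_mat m' c"
    and u: "u \<in> carrier_vec m" and xy: "x \<in> carrier_vec n" "y \<in> carrier_vec c"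
  shows "\<psi> (x - HX\<^sup>T *\<^sub>v u, y - FX\<^sup>T *\<^sub>v u) = \<psi> (x, y)"
proof -
  have "X_op (HX\<^sup>T *\<^sub>v u) (FX\<^sup>T *\<^sub>v u) (Z_op (HZ\<^sup>T *\<^sub>v 0\<^sub>v m') (FZ\<^sup>T *\<^sub>v 0\<^sub>v m') \<psi>) (x, y) = \<psi> (x, y)"
    using \<psi> dims u xy unfolding stabilized_space_def basis_idx_def by auto
  then show ?thesis
    using dims u xy by (simp add: X_op_def Z_op_def add_char_0[OF pp] scalar_prod_def)
qed

text \<open>The case u = 0, applied to all multiples of v: at a nonzero amplitude the phase is 1 for
  every multiple b, so the check value itself vanishes.\<close>

lemma stabilized_space_support:
  fixes HX HZ FX FZ :: "'a::{field,finite} mat"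
  assumes pp: "primepow CARD('a)"
    and \<psi>: "\<psi> \<in> stabilized_space n c HX HZ FX FZ"
    and dims: "HX \<in> carrier_mat m n" "HZ \<in> carrier_mat m' n" "FX \<in> carrier_mat m c" "FZ \<in> carrier_mat m' c"
    and v: "v \<in> carrier_vec m'" and xy: "x \<in> carrier_vec n" "y \<in> carrier_vec c"
    and nz: "\<psi> (x, y) \<noteq> 0"
  shows "(HZ\<^sup>T *\<^sub>v v) \<bullet> x + (FZ\<^sup>T *\<^sub>v v) \<bullet> y = 0"
proof (rule add_char_separates[OF pp])
  fix b :: 'a
  let ?h = "HZ\<^sup>T *\<^sub>v v" and ?g = "FZ\<^sup>T *\<^sub>v v"
  have zero: "HX\<^sup>T *\<^sub>v 0\<^sub>v m = 0\<^sub>v n" "FX\<^sup>T *\<^sub>v 0\<^sub>v m = 0\<^sub>v c"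
    using dims by (auto intro!: eq_vecI)
  have smult: "HZ\<^sup>T *\<^sub>v (b \<cdot>\<^sub>v v) = b \<cdot>\<^sub>v ?h" "FZ\<^sup>T *\<^sub>v (b \<cdot>\<^sub>v v) = b \<cdot>\<^sub>v ?g"
    using dims v by (auto intro!: mult_mat_vec)
  have "X_op (HX\<^sup>T *\<^sub>v 0\<^sub>v m) (FX\<^sup>T *\<^sub>v 0\<^sub>v m) (Z_op (HZ\<^sup>T *\<^sub>v (b \<cdot>\<^sub>v v)) (FZ\<^sup>T *\<^sub>v (b \<cdot>\<^sub>v v)) \<psi>) (x, y) = \<psi> (x, y)"
    using \<psi> dims v xy unfolding stabilized_space_def basis_idx_def by auto
  moreover have "x - 0\<^sub>v n = x" "y - 0\<^sub>v c = y" using xy by auto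
  ultimately have "(\<Prod>j<n. add_char (b * (?h $ j * x $ j))) * (\<Prod>j<c. add_char (b * (?g $ j * y $ j))) = 1"
    using nz dims unfolding zero smult by (simp add: X_op_def Z_op_def mult.assoc)
  then show "add_char (b * (?h \<bullet> x + ?g \<bullet> y)) = 1"
    using xy by (simp add: scalar_prod_def add_char_add[OF pp] add_char_sum[OF pp] distrib_left
        sum_distrib_left atLeast0LessThan)
qed

text \<open>Both scalar products have the form of u paired with
  \<open>(A * B\<^sup>T) *\<^sub>v v\<close>, and the minus sign in the rank factorization makes
  them cancel.\<close>

lemma stabilizers_commute:
  fixes HX HZ FX FZ :: "'a::field mat"
  assumes dims: "HX \<in> carrier_mat m n" "HZ \<in> carrier_mat m' n" "FX \<in> carrier_mat m c" "FZ \<in> carrier_mat m' c"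
    and fact: "- (HX * HZ\<^sup>T) = FX * FZ\<^sup>T"
    and uv: "u \<in> carrier_vec m" "v \<in> carrier_vec m'"
  shows "(HZ\<^sup>T *\<^sub>v v) \<bullet> (HX\<^sup>T *\<^sub>v u) + (FZ\<^sup>T *\<^sub>v v) \<bullet> (FX\<^sup>T *\<^sub>v u) = 0"
proof -
  have bil: "(B\<^sup>T *\<^sub>v v) \<bullet> (A\<^sup>T *\<^sub>v u) = u \<bullet> ((A * B\<^sup>T) *\<^sub>v v)"
    if A: "A \<in> carrier_mat m k" and B: "B \<in> carrier_mat m' k" for A B :: "'a mat" and k
  proof -
    have Bv: "B\<^sup>T *\<^sub>v v \<in> carrier_vec k" and Au: "A\<^sup>T *\<^sub>v u \<in> carrier_vec k" using A B uv by auto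
    have "(B\<^sup>T *\<^sub>v v) \<bullet> (A\<^sup>T *\<^sub>v u) = (A\<^sup>T *\<^sub>v u) \<bullet> (B\<^sup>T *\<^sub>v v)"
      by (rule comm_scalar_prod[OF Bv Au])
    also have "\<dots> = u \<bullet> (A *\<^sub>v (B\<^sup>T *\<^sub>v v))" by (rule transpose_vec_mult_scalar[OF A Bv uv(1)])
    also have "A *\<^sub>v (B\<^sup>T *\<^sub>v v) = (A * B\<^sup>T) *\<^sub>v v" using A B uv by (metis assoc_mult_mat_vec transpose_carrier_mat)
    finally show ?thesis .
  qed
  have P: "HX * HZ\<^sup>T \<in> carrier_mat m m'" using dims by auto
  have "u \<bullet> (- (HX * HZ\<^sup>T) *\<^sub>v v) = - (u \<bullet> ((HX * HZ\<^sup>T) *\<^sub>v v))"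
  proof -
    have "- (HX * HZ\<^sup>T) *\<^sub>v v = - ((HX * HZ\<^sup>T) *\<^sub>v v)"
      using P uv by (intro eq_vecI) (auto simp: scalar_prod_def sum_negf simp del: index_mult_mat)
    then show ?thesis using P uv by (simp add: scalar_prod_def sum_negf del: index_mult_mat)
  qed
  then show ?thesis
    using bil[OF dims(1,2)] bil[OF dims(3,4)] by (simp flip: fact)
qed

text \<open>The two dual words at i extend to stabilizers that act on the receiver register as well.
  The recovery set is the union of their supports without i.\<close>

lemma css_support_condition_imp_locally_recoverable:
  fixes HX HZ FX FZ :: "'a::{field,finite} mat"
  assumes pp: "primepow CARD('a)"
    and dims: "HX \<in> carrier_mat m n" "HZ \<in> carrier_mat m' n" "FX \<in> carrier_mat m c" "FZ \<in> carrier_mat m' c"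
    and fact: "- (HX * HZ\<^sup>T) = FX * FZ\<^sup>T"
    and dual: "dual_code n CX = (*\<^sub>v) HX\<^sup>T ` carrier_vec m" "dual_code n CZ = (*\<^sub>v) HZ\<^sup>T ` carrier_vec m'"
    and cond: "css_support_condition n r CX CZ"
  shows "locally_recoverable n c r (stabilized_space n c HX HZ FX FZ)"
  unfolding locally_recoverable_def
proof (intro allI impI)
  fix i assume i: "i < n"
  obtain u v where uv: "u \<in> carrier_vec m" "v \<in> carrier_vec m'"
    and iS: "i \<in> vsupp (HX\<^sup>T *\<^sub>v u) \<inter> vsupp (HZ\<^sup>T *\<^sub>v v)"
    and card: "card (vsupp (HX\<^sup>T *\<^sub>v u) \<union> vsupp (HZ\<^sup>T *\<^sub>v v)) \<le> r + 1"
    using cond i unfolding css_support_condition_def dual by blast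
  define S where "S = vsupp (HX\<^sup>T *\<^sub>v u) \<union> vsupp (HZ\<^sup>T *\<^sub>v v)"
  have Sn: "S \<subseteq> {..<n}" using dims by (auto simp: S_def vsupp_def)
  then have finS: "finite S" by (rule finite_subset) simp
  interpret qudit_recovery n c i S "HX\<^sup>T *\<^sub>v u" "HZ\<^sup>T *\<^sub>v v" "FX\<^sup>T *\<^sub>v u" "FZ\<^sup>T *\<^sub>v v"
  proof
    show "(HZ\<^sup>T *\<^sub>v v) \<bullet> (HX\<^sup>T *\<^sub>v u) + (FZ\<^sup>T *\<^sub>v v) \<bullet> (FX\<^sup>T *\<^sub>v u) = 0"
      by (rule stabilizers_commute[OF dims fact uv])
  qed (use dims uv i iS in \<open>auto simp: S_def vsupp_def\<close>)
  have ins: "insert i (S - {i}) = S" using iS by (auto simp: S_def)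
  show "\<exists>R\<subseteq>{..<n} - {i}. card R \<le> r \<and>
      (\<exists>\<Phi>. quantum_channel (local_idx n c (insert i R)) \<Phi> \<and>
        (\<forall>\<psi>\<in>stabilized_space n c HX HZ FX FZ. unit_state n c \<psi> \<longrightarrow>
          (\<forall>\<omega>\<in>basis_idx n c. \<forall>\<omega>'\<in>basis_idx n c.
            local_apply (insert i R) \<Phi> (erase_qudit i (pure_density \<psi>)) \<omega> \<omega>' = pure_density \<psi> \<omega> \<omega>')))"
  proof (intro exI[of _ "S - {i}"] conjI exI[of _ recover] ballI impI, unfold ins)
    show "S - {i} \<subseteq> {..<n} - {i}" using Sn by blast
    show "card (S - {i}) \<le> r" using card finS iS by (simp add: S_def card_Diff_singleton)
    show "quantum_channel (local_idx n c S) recover" by (rule quantum_channel_recover)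
    fix \<psi> :: "'a state" and \<omega> \<omega>' :: "'a vec \<times> 'a vec"
    assume \<psi>: "\<psi> \<in> stabilized_space n c HX HZ FX FZ"
      and \<omega>: "\<omega> \<in> basis_idx n c" "\<omega>' \<in> basis_idx n c"
    show "local_apply S recover (erase_qudit i (pure_density \<psi>)) \<omega> \<omega>' = pure_density \<psi> \<omega> \<omega>'"
    proof (rule recover_erased[OF _ _ \<omega>])
      fix \<alpha> :: "'a vec \<times> 'a vec" and t assume \<alpha>: "\<alpha> \<in> basis_idx n c"
      obtain x y where xy: "\<alpha> = (x, y)" "x \<in> carrier_vec n" "y \<in> carrier_vec c"
        using \<alpha> by (auto simp: basis_idx_def)
      let ?a = "(x $ i - t) / (HX\<^sup>T *\<^sub>v u) $ i"
      have "HX\<^sup>T *\<^sub>v (?a \<cdot>\<^sub>v u) = ?a \<cdot>\<^sub>v (HX\<^sup>T *\<^sub>v u)" "FX\<^sup>T *\<^sub>v (?a \<cdot>\<^sub>v u) = ?a \<cdot>\<^sub>v (FX\<^sup>T *\<^sub>v u)"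
        using dims uv by (auto intro!: mult_mat_vec)
      then show "\<psi> (shift t \<alpha>) = \<psi> \<alpha>"
        using stabilized_space_shift[OF pp \<psi> dims smult_carrier_vec[THEN iffD2, OF uv(1), of ?a] xy(2,3)]
        by (simp add: shift_def xy(1))
    next
      fix \<alpha> :: "'a vec \<times> 'a vec" assume \<alpha>: "\<alpha> \<in> basis_idx n c" "\<psi> \<alpha> \<noteq> 0"
      obtain x y where xy: "\<alpha> = (x, y)" "x \<in> carrier_vec n" "y \<in> carrier_vec c"
        using \<alpha> by (auto simp: basis_idx_def)
      show "check \<alpha> = 0"
        using stabilized_space_support[OF pp \<psi> dims uv(2) xy(2,3)] \<alpha> by (simp add: check_def xy(1))
    qed
  qed
qed

section \<open>Codes checked by block indicators and powers\<close>

text \<open>Block k consists of the positions from kN to kN + N - 1. Distinctness of the points is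
  assumed only within a block, because for small distances all blocks share the same points.\<close>

locale lrc_points =
  fixes N u :: nat and pt :: "nat \<Rightarrow> 'a::{field,finite}"
  assumes N_pos: "N > 0" and u_pos: "u > 0" and N_nonzero: "of_nat N \<noteq> (0::'a)"
    and pt_nonzero: "\<And>j. j < u * N \<Longrightarrow> pt j \<noteq> 0"
    and pt_inj_block: "\<And>k. k < u \<Longrightarrow> inj_on pt {k * N..<k * N + N}"
    and pt_block_sum: "\<And>k e. k < u \<Longrightarrow> \<bar>e\<bar> < int N \<Longrightarrow>
       (\<Sum>j\<in>{k * N..<k * N + N}. pt j powi e) = (if e = 0 then of_nat N else 0)"
begin

text \<open>The column weights \<open>w\<close> serve to keep the diagonal entries belonging to
  power rows nonzero: such an entry of a product is N times a sum of block weights, which could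
  vanish for constant weights.\<close>

definition checks :: "(nat \<Rightarrow> 'a) \<Rightarrow> (nat \<Rightarrow> int) \<Rightarrow> nat \<Rightarrow> 'a mat" where
  "checks w e m = mat (u + m) (u * N) (\<lambda>(i, j).
     w (j div N) * (if i < u then (if i = j div N then 1 else 0) else pt j powi e (i - u)))"

definition checks_diag :: "(nat \<Rightarrow> 'a) \<Rightarrow> nat \<Rightarrow> 'a" where
  "checks_diag w i = of_nat N * (if i < u then w i else (\<Sum>k<u. w k))"

lemma checks_carrier [simp]:
  "checks w e m \<in> carrier_mat (u + m) (u * N)"
  "dim_row (checks w e m) = u + m" "dim_col (checks w e m) = u * N"
  by (simp_all add: checks_def)

lemma block_div: "k * N \<le> j \<Longrightarrow> j < k * N + N \<Longrightarrow> j div N = k"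
  by (auto intro!: div_nat_eqI simp: mult.commute)

lemma block_subset: "k < u \<Longrightarrow> {k * N..<k * N + N} \<subseteq> {..<u * N}"
  using mult_le_mono1[of "Suc k" u N] by auto

lemma div_less_blocks: "j < u * N \<Longrightarrow> j div N < u"
  by (simp add: less_mult_imp_div_less)

lemma mem_block: "j \<in> {j div N * N..<j div N * N + N}"
  using N_pos by (simp add: dividend_less_div_times add.commute)

lemma sum_blocks: "(\<Sum>j<u * N. g j) = (\<Sum>k<u. \<Sum>j\<in>{k * N..<k * N + N}. (g j :: 'a))"
  by (rule sum.nat_group[symmetric])

text \<open>Each entry is a weighted sum over the blocks of power sums with the exponent of the row
  plus that of the column. These vanish unless the exponents cancel, which happens only on the
  diagonal and, among the powers, only for the first s of them.\<close>

lemma checks_mult_transpose: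
  assumes e: "\<And>t. t < m \<Longrightarrow> e t \<noteq> 0 \<and> \<bar>e t\<bar> < int N" "\<And>t. t < m \<Longrightarrow> e' t \<noteq> 0 \<and> \<bar>e' t\<bar> < int N"
    and ee': "\<And>t t'. t < m \<Longrightarrow> t' < m \<Longrightarrow> \<bar>e t + e' t'\<bar> < int N \<and> (e t + e' t' = 0 \<longleftrightarrow> t = t' \<and> t < s)"
    and "s \<le> m"
  shows "checks w e m * (checks w' e' m)\<^sup>T = partial_diag (u + m) (u + s) (checks_diag (\<lambda>k. w k * w' k))"
proof (rule eq_matI; (unfold partial_diag_carrier)?)
  fix i i' assume "i < u + m" "i' < u + m"
  \<comment> \<open>An indicator row is treated as a row of exponent 0 that \<kappa> restricts to
    one block, so that all kinds of entries are computed at once.\<close>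
  define \<kappa> :: "nat \<Rightarrow> nat \<Rightarrow> 'a" where "\<kappa> i k = (if i < u then if i = k then 1 else 0 else 1)" for i k
  define \<epsilon> where "\<epsilon> f i = (if i < u then 0 else f (i - u))" for f :: "nat \<Rightarrow> int" and i
  have entry: "checks w f m $$ (i, j) = w k * \<kappa> i k * pt j powi \<epsilon> f i"
    if "i < u + m" "k < u" "j \<in> {k * N..<k * N + N}" for w f i j k
  proof -
    have "j < u * N" "j div N = k" using that block_subset[of k] by (auto simp: block_div)
    then show ?thesis using that(1) by (simp add: checks_def \<kappa>_def \<epsilon>_def)
  qed
  have sm: "\<bar>\<epsilon> e i + \<epsilon> e' i'\<bar> < int N"
    using e[of "i - u"] e(2)[of "i' - u"] ee'[of "i - u" "i' - u"] \<open>i < u + m\<close> \<open>i' < u + m\<close> N_pos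
    by (auto simp: \<epsilon>_def)
  have "(checks w e m * (checks w' e' m)\<^sup>T) $$ (i, i') = (\<Sum>j<u * N. checks w e m $$ (i, j) * checks w' e' m $$ (i', j))"
    using \<open>i < u + m\<close> \<open>i' < u + m\<close> by (simp add: scalar_prod_def atLeast0LessThan)
  also have "\<dots> = (\<Sum>k<u. \<Sum>j\<in>{k * N..<k * N + N}. w k * w' k * \<kappa> i k * \<kappa> i' k * pt j powi (\<epsilon> e i + \<epsilon> e' i'))"
    unfolding sum_blocks
  proof (intro sum.cong refl)
    fix k j assume k: "k \<in> {..<u}" and j: "j \<in> {k * N..<k * N + N}"
    then have "pt j \<noteq> 0" using block_subset[of k] by (intro pt_nonzero) auto
    then show "checks w e m $$ (i, j) * checks w' e' m $$ (i', j) =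
        w k * w' k * \<kappa> i k * \<kappa> i' k * pt j powi (\<epsilon> e i + \<epsilon> e' i')"
      using k entry[OF \<open>i < u + m\<close> _ j] entry[OF \<open>i' < u + m\<close> _ j]
      by (simp add: power_int_add mult_ac)
  qed
  also have "\<dots> = (\<Sum>k<u. w k * w' k * \<kappa> i k * \<kappa> i' k * (if \<epsilon> e i + \<epsilon> e' i' = 0 then of_nat N else 0))"
    using sm by (intro sum.cong refl) (simp add: pt_block_sum flip: sum_distrib_left)
  also have "\<dots> = partial_diag (u + m) (u + s) (checks_diag (\<lambda>k. w k * w' k)) $$ (i, i')"
  proof -
    consider "i < u" "i' < u" | "i < u" "i' \<ge> u" | "i \<ge> u" "i' < u" | "i \<ge> u" "i' \<ge> u" by linarith
    then show ?thesis
    proof cases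
      case 1
      have "(\<Sum>k<u. w k * w' k * \<kappa> i k * \<kappa> i' k * (if \<epsilon> e i + \<epsilon> e' i' = 0 then of_nat N else 0)) =
          (\<Sum>k<u. if k = i then (if i = i' then w i * w' i * of_nat N else 0) else 0)"
        using 1 by (intro sum.cong refl) (auto simp: \<kappa>_def \<epsilon>_def)
      then show ?thesis using 1 by (simp add: partial_diag_def checks_diag_def)
    next
      case 2
      then show ?thesis using e(2)[of "i' - u"] \<open>i' < u + m\<close> by (simp add: partial_diag_def \<epsilon>_def)
    next
      case 3
      then show ?thesis using e(1)[of "i - u"] \<open>i < u + m\<close> by (simp add: partial_diag_def \<epsilon>_def)
    next
      case 4
      have "(i - u = i' - u \<and> i - u < s) = (i = i' \<and> i < u + s)" using 4 by auto
      then show ?thesis using 4 ee'[of "i - u" "i' - u"] \<open>i < u + m\<close> \<open>i' < u + m\<close>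
        by (simp add: partial_diag_def checks_diag_def \<kappa>_def \<epsilon>_def mult.commute flip: sum_distrib_right)
    qed
  qed
  finally show "(checks w e m * (checks w' e' m)\<^sup>T) $$ (i, i') = partial_diag (u + m) (u + s) (checks_diag (\<lambda>k. w k * w' k)) $$ (i, i')" .
qed auto

lemma checks_diag_nonzero:
  assumes "\<And>k. w k \<noteq> 0" "(\<Sum>k<u. w k) \<noteq> 0"
  shows "checks_diag w i \<noteq> 0"
  using assms N_nonzero by (simp add: checks_diag_def)

text \<open>Against the matrix with opposite exponents the product is diagonal without zeros on the
  diagonal; rescaling by its inverse finishes. The second weight \<open>w'\<close> ensures that the
  relevant sum of weights is nonzero.\<close>

lemma checks_right_inverse:
  assumes e: "\<And>t. t < m \<Longrightarrow> e t \<noteq> 0 \<and> \<bar>e t\<bar> < int N" "inj_on e {..<m}"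
    "\<And>t t'. t < m \<Longrightarrow> t' < m \<Longrightarrow> \<bar>e t - e t'\<bar> < int N"
    and w: "\<And>k. w k * w' k \<noteq> 0" "(\<Sum>k<u. w k * w' k) \<noteq> 0"
  obtains R where "R \<in> carrier_mat (u * N) (u + m)" "checks w e m * R = 1\<^sub>m (u + m)"
proof -
  let ?D = "checks_diag (\<lambda>k. w k * w' k)"
  let ?T = "(checks w' (\<lambda>t. - e t) m)\<^sup>T"
  let ?I = "partial_diag (u + m) (u + m) (\<lambda>i. inverse (?D i))"
  have T: "?T \<in> carrier_mat (u * N) (u + m)" by (simp add: carrier_matI)
  have "checks w e m * ?T = partial_diag (u + m) (u + m) ?D"
    using e by (intro checks_mult_transpose) (auto dest: inj_onD)
  moreover have "checks w e m * (?T * ?I) = checks w e m * ?T * ?I"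
    by (rule assoc_mult_mat[symmetric, OF _ T]) auto
  moreover have "partial_diag (u + m) (u + m) ?D * ?I = 1\<^sub>m (u + m)"
  proof (rule eq_matI)
    fix i j assume "i < dim_row (1\<^sub>m (u + m) :: 'a mat)" "j < dim_col (1\<^sub>m (u + m) :: 'a mat)"
    then have ij: "i < u + m" "j < u + m" by auto
    have "(partial_diag (u + m) (u + m) ?D * ?I) $$ (i, j) = (partial_diag (u + m) (u + m) ?D *\<^sub>v col ?I j) $ i"
      using ij by simp
    also have "\<dots> = ?D i * ?I $$ (i, j)" using ij by (subst partial_diag_mult_vec) auto
    also have "\<dots> = (1\<^sub>m (u + m) :: 'a mat) $$ (i, j)"
      using ij checks_diag_nonzero[OF w] by (simp add: partial_diag_def)
    finally show "(partial_diag (u + m) (u + m) ?D * ?I) $$ (i, j) = (1\<^sub>m (u + m) :: 'a mat) $$ (i, j)" .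
  qed auto
  ultimately show ?thesis using T by (intro that[of "?T * ?I"]) auto
qed

lemma kernel_checks_block_sum:
  assumes x: "x \<in> mat_kernel (checks w e m)" and "k < u" "w k \<noteq> 0"
  shows "(\<Sum>j\<in>{k * N..<k * N + N}. x $ j) = 0"
proof -
  have xc: "x \<in> carrier_vec (u * N)" and z: "checks w e m *\<^sub>v x = 0\<^sub>v (u + m)"
    using x by (auto simp: mat_kernel[OF checks_carrier(1)])
  have "0 = (checks w e m *\<^sub>v x) $ k" using z assms(2) by simp
  also have "\<dots> = (\<Sum>j<u * N. w (j div N) * (if k = j div N then 1 else 0) * x $ j)"
    using xc assms(2) by (auto simp: checks_def scalar_prod_def atLeast0LessThan intro!: sum.cong)
  also have "\<dots> = (\<Sum>k'<u. \<Sum>j\<in>{k' * N..<k' * N + N}. if k' = k then w k * x $ j else 0)"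
    unfolding sum_blocks by (intro sum.cong refl) (auto simp: block_div)
  also have "\<dots> = (\<Sum>k'<u. if k' = k then w k * (\<Sum>j\<in>{k * N..<k * N + N}. x $ j) else 0)"
    by (intro sum.cong refl) (auto simp: sum_distrib_left)
  also have "\<dots> = w k * (\<Sum>j\<in>{k * N..<k * N + N}. x $ j)" using assms(2) by simp
  finally show ?thesis using assms(3) by simp
qed

lemma kernel_checks_power_sum:
  assumes x: "x \<in> mat_kernel (checks w e m)" and "t < m"
  shows "(\<Sum>j<u * N. w (j div N) * x $ j * pt j powi e t) = 0"
proof -
  have xc: "x \<in> carrier_vec (u * N)" and z: "checks w e m *\<^sub>v x = 0\<^sub>v (u + m)"
    using x by (auto simp: mat_kernel[OF checks_carrier(1)])
  have "0 = (checks w e m *\<^sub>v x) $ (u + t)" using z assms(2) by simp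
  also have "\<dots> = (\<Sum>j<u * N. w (j div N) * x $ j * pt j powi e t)"
    using xc assms(2) by (auto simp: checks_def scalar_prod_def atLeast0LessThan mult_ac intro!: sum.cong)
  finally show ?thesis by simp
qed

text \<open>The entries of a kernel vector sum to zero over each block, so a nonzero entry is never
  alone in its block.\<close>

lemma kernel_checks_block_support:
  assumes x: "x \<in> mat_kernel (checks w e m)" and w: "\<And>k. w k \<noteq> 0" and j: "j \<in> vsupp x"
  obtains j' where "j' \<in> vsupp x" "j' \<noteq> j" "j' div N = j div N"
proof (rule ccontr)
  note found = that
  assume no: "\<not> thesis"
  have xc: "x \<in> carrier_vec (u * N)"
    using x by (auto simp: mat_kernel[OF checks_carrier(1)])
  let ?k = "j div N"
  have k: "?k < u" using j xc by (intro div_less_blocks) (auto simp: vsupp_def)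
  have "x $ j' = 0" if that': "j' \<in> {?k * N..<?k * N + N} - {j}" for j'
  proof (rule ccontr)
    assume "x $ j' \<noteq> 0"
    moreover have "j' < u * N" "j' div N = ?k" using that' block_subset[OF k] by (auto simp: block_div)
    ultimately show False using no found[of j'] that' xc by (auto simp: vsupp_def)
  qed
  then have "(\<Sum>j'\<in>{?k * N..<?k * N + N}. x $ j') = x $ j"
    using mem_block[of j] by (subst sum.remove[of _ j]) auto
  then show False using kernel_checks_block_sum[OF x k w] j by (simp add: vsupp_def)
qed

text \<open>The m + 1 consecutive exponents a, ..., a + m form a Vandermonde system, which admits no
  nonzero solution supported on at most m + 1 positions with distinct points. Distinctness holds
  globally or, for m \<le> 2, because so small a support lies in one block.\<close>

lemma kernel_checks_min_weight:
  assumes x: "x \<in> mat_kernel (checks w e m)" "x \<noteq> 0\<^sub>v (u * N)" and w: "\<And>k. w k \<noteq> 0"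
    and e: "\<And>k. k \<le> m \<Longrightarrow> a + int k = 0 \<or> (\<exists>t<m. e t = a + int k)"
    and inj: "inj_on pt {..<u * N} \<or> m \<le> 2"
  shows "m + 2 \<le> card (vsupp x)"
proof (rule ccontr)
  assume "\<not> m + 2 \<le> card (vsupp x)"
  then have card: "card (vsupp x) \<le> Suc m" by simp
  have xc: "x \<in> carrier_vec (u * N)"
    using x by (auto simp: mat_kernel[OF checks_carrier(1)])
  have supp: "vsupp x \<subseteq> {..<u * N}" using xc by (auto simp: vsupp_def)
  then have fin: "finite (vsupp x)" by (rule finite_subset) simp
  obtain j0 where j0: "j0 \<in> vsupp x"
    using x(2) xc by (metis (mono_tags, lifting) carrier_vecD eq_vecI index_zero_vec mem_Collect_eq vsupp_def)
  have inj_supp: "inj_on pt (vsupp x)"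
    using inj
  proof
    assume "inj_on pt {..<u * N}"
    then show ?thesis using supp by (rule inj_on_subset)
  next
    assume "m \<le> 2"
    \<comment> \<open>Two different blocks would each contain two support positions, four in total,
      against a bound of three.\<close>
    have "j div N = j0 div N" if j: "j \<in> vsupp x" for j
    proof (rule ccontr)
      assume ne: "j div N \<noteq> j0 div N"
      obtain j' where j': "j' \<in> vsupp x" "j' \<noteq> j" "j' div N = j div N"
        by (rule kernel_checks_block_support[OF x(1) w j])
      obtain j1 where j1: "j1 \<in> vsupp x" "j1 \<noteq> j0" "j1 div N = j0 div N"
        by (rule kernel_checks_block_support[OF x(1) w j0])
      have "j \<notin> {j0, j1}" "j' \<notin> {j0, j1}" using ne j' j1 by auto
      then have "card {j, j', j0, j1} = 4" using j'(2) j1(2) by auto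
      moreover have "card {j, j', j0, j1} \<le> card (vsupp x)"
        using j j' j0 j1 by (intro card_mono fin) auto
      ultimately show False using card \<open>m \<le> 2\<close> by simp
    qed
    then have "vsupp x \<subseteq> {j0 div N * N..<j0 div N * N + N}" using mem_block by (metis subsetI)
    then show ?thesis
      using pt_inj_block[of "j0 div N"] j0 supp div_less_blocks by (meson inj_on_subset lessThan_iff subsetD)
  qed
  have "w (j0 div N) * x $ j0 = 0"
  proof (rule vandermonde_independent[OF fin inj_supp _ card _ j0, where c = "\<lambda>j. w (j div N) * x $ j"])
    show "pt j \<noteq> 0" if "j \<in> vsupp x" for j using that supp pt_nonzero by blast
    fix k assume "k < Suc m"
    have "(\<Sum>j\<in>vsupp x. w (j div N) * x $ j * pt j powi (a + int k)) =
        (\<Sum>j<u * N. w (j div N) * x $ j * pt j powi (a + int k))"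
      using supp xc by (intro sum.mono_neutral_left) (auto simp: vsupp_def)
    also have "\<dots> = 0"
    proof (cases "a + int k = 0")
      \<comment> \<open>The exponent 0 is not among the power rows; its equation is the sum of the
        block indicator equations.\<close>
      case True
      have "(\<Sum>j<u * N. w (j div N) * x $ j) = (\<Sum>k<u. \<Sum>j\<in>{k * N..<k * N + N}. w k * x $ j)"
        unfolding sum_blocks by (intro sum.cong refl) (auto simp: block_div)
      also have "\<dots> = 0"
        using kernel_checks_block_sum[OF x(1) _ w] by (simp flip: sum_distrib_left)
      finally show ?thesis by (simp add: True)
    next
      case False
      then obtain t where "t < m" "e t = a + int k" using e[of k] \<open>k < Suc m\<close> by auto
      then show ?thesis using kernel_checks_power_sum[OF x(1)] by metis
    qed
    finally show "(\<Sum>j\<in>vsupp x. w (j div N) * x $ j * pt j powi (a + int k)) = 0" .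
  qed
  then show False using w j0 by (simp add: vsupp_def)
qed

text \<open>The first m + 2 positions lie in block 0, where only one indicator row and the m power
  rows can be nonzero: m + 1 equations for m + 2 unknowns.\<close>

lemma exists_low_weight_kernel_checks:
  assumes "m + 2 \<le> N"
  obtains x where "x \<in> mat_kernel (checks w e m)" "x \<noteq> 0\<^sub>v (u * N)" "vsupp x \<subseteq> {..<m + 2}"
proof -
  have N_le: "m + 2 \<le> u * N" using u_pos by (intro order.trans[OF assms]) simp
  \<comment> \<open>Selects row 0, the indicator of block 0, followed by the power rows u, ..., u +
    m - 1.\<close>
  let ?r = "\<lambda>i. if i = 0 then 0 else u + i - 1"
  let ?A = "mat (m + 1) (m + 2) (\<lambda>(i, j). checks w e m $$ (?r i, j))"
  obtain y where y: "y \<in> carrier_vec (m + 2)" "y \<noteq> 0\<^sub>v (m + 2)" "?A *\<^sub>v y = 0\<^sub>v (m + 1)"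
    by (rule exists_nonzero_kernel_vec[of ?A "m + 1" "m + 2"]) auto
  let ?x = "vec (u * N) (\<lambda>j. if j < m + 2 then y $ j else 0)"
  have row: "(\<Sum>j<m + 2. checks w e m $$ (?r i, j) * y $ j) = 0" if "i < m + 1" for i
    using arg_cong[OF y(3), of "\<lambda>v. v $ i"] that y(1) by (simp add: scalar_prod_def atLeast0LessThan)
  show ?thesis
  proof (rule that[of ?x])
    show "?x \<noteq> 0\<^sub>v (u * N)"
    proof
      assume x0: "?x = 0\<^sub>v (u * N)"
      have "y $ j = 0" if "j < m + 2" for j
        using arg_cong[OF x0, of "\<lambda>v. v $ j"] that assms N_le by simp
      then show False using y by (auto intro: eq_vecI)
    qed
    show "vsupp ?x \<subseteq> {..<m + 2}" by (auto simp: vsupp_def split: if_splits)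
    have "(checks w e m *\<^sub>v ?x) $ i = 0" if i: "i < u + m" for i
    proof -
      have "(checks w e m *\<^sub>v ?x) $ i = (\<Sum>j<u * N. checks w e m $$ (i, j) * (if j < m + 2 then y $ j else 0))"
        using i by (simp add: scalar_prod_def atLeast0LessThan)
      also have "\<dots> = (\<Sum>j<m + 2. checks w e m $$ (i, j) * y $ j)"
        using assms N_le by (intro sum.mono_neutral_cong_right) auto
      also have "\<dots> = 0"
      proof (cases "0 < i \<and> i < u")
        case True
        then show ?thesis using assms N_le i by (intro sum.neutral) (auto simp: checks_def)
      next
        case False
        then obtain i' where "i' < m + 1" "i = ?r i'"
          using i u_pos by (cases "i = 0") (auto intro: that[of 0] that[of "i - u + 1"])
        then show ?thesis using row by blast
      qed
      finally show ?thesis .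
    qed
    then show "?x \<in> mat_kernel (checks w e m)"
      by (auto simp: mat_kernel[OF checks_carrier(1)] simp del: index_mult_mat_vec intro!: eq_vecI)
  qed
qed

text \<open>Writing x as the row combination given by y, the first checks force y to vanish below u
  + s. Only positive powers remain, so x is a polynomial of degree below m - s in the points, times
  nonzero factors. It vanishes on N - m - 2 \<ge> m points of block 0, hence everywhere.\<close>

lemma low_weight_not_in_row_space:
  assumes x: "x \<in> mat_kernel (checks w e m)" "x \<noteq> 0\<^sub>v (u * N)" "vsupp x \<subseteq> {..<m + 2}"
    and prod: "checks w e m * (checks w' e' m)\<^sup>T = partial_diag (u + m) (u + s) D"
    and D: "\<And>i. D i \<noteq> 0" and w': "\<And>k. w' k \<noteq> 0"
    and e': "\<And>t. s \<le> t \<Longrightarrow> t < m \<Longrightarrow> e' t = int (t - s) + 1"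
    and "s \<le> m" "2 * m + 2 \<le> N"
  shows "x \<notin> (*\<^sub>v) (checks w' e' m)\<^sup>T ` carrier_vec (u + m)"
proof
  assume "x \<in> (*\<^sub>v) (checks w' e' m)\<^sup>T ` carrier_vec (u + m)"
  then obtain y where y: "y \<in> carrier_vec (u + m)" "x = (checks w' e' m)\<^sup>T *\<^sub>v y" by blast
  have N_le: "N \<le> u * N" using u_pos by simp
  have "0\<^sub>v (u + m) = checks w e m *\<^sub>v x" using x(1) by (auto simp: mat_kernel[OF checks_carrier(1)])
  also have "\<dots> = partial_diag (u + m) (u + s) D *\<^sub>v y"
    unfolding y(2) prod[symmetric]
    by (rule assoc_mult_mat_vec[symmetric, of _ "u + m" "u * N" _ "u + m"]) (use y in auto)
  finally have y_low: "y $ i = 0" if "i < u + s" for i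
    using partial_diag_mult_vec_eq_0_iff[OF y(1), of "u + s" D] D assms(8) that by simp
  \<comment> \<open>One factor of the point is split off from each remaining power, which lowers the
    exponent t - s + 1 to t - s.\<close>
  let ?P = "\<Sum>t\<in>{s..<m}. Polynomial.monom (y $ (u + t)) (t - s)"
  have x_eq: "x $ j = w' (j div N) * pt j * poly ?P (pt j)" if j: "j < u * N" for j
  proof -
    have "x $ j = (\<Sum>i\<in>{0..<u + m}. checks w' e' m $$ (i, j) * y $ i)"
      using j y by (simp add: scalar_prod_def)
    also have "\<dots> = (\<Sum>i\<in>{u + s..<u + m}. checks w' e' m $$ (i, j) * y $ i)"
      using y_low by (intro sum.mono_neutral_right) auto
    also have "\<dots> = (\<Sum>t\<in>{s..<m}. checks w' e' m $$ (u + t, j) * y $ (u + t))"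
      by (rule sum.reindex_bij_witness[of _ "\<lambda>t. u + t" "\<lambda>i. i - u"]) auto
    also have "\<dots> = (\<Sum>t\<in>{s..<m}. w' (j div N) * pt j * (y $ (u + t) * pt j ^ (t - s)))"
    proof (intro sum.cong refl)
      fix t assume t: "t \<in> {s..<m}"
      have "e' t = int (Suc (t - s))" using t e'[of t] by simp
      then have "pt j powi e' t = pt j ^ (t - s) * pt j"
        by (simp only: power_int_of_nat power_Suc2)
      then show "checks w' e' m $$ (u + t, j) * y $ (u + t) = w' (j div N) * pt j * (y $ (u + t) * pt j ^ (t - s))"
        using t j by (simp add: checks_def mult_ac)
    qed
    finally show ?thesis by (simp add: poly_sum poly_monom sum_distrib_left)
  qed
  have roots: "poly ?P (pt j) = 0" if j: "j \<in> {m + 2..<N}" for j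
  proof -
    have "j < u * N" using j by (intro order.strict_trans2[OF _ N_le]) simp
    moreover have "x $ j = 0"
      using x(3) j \<open>j < u * N\<close> y(2) by (auto simp: vsupp_def)
    ultimately show ?thesis using x_eq[of j] w' pt_nonzero by simp
  qed
  have "?P = 0"
  proof (rule ccontr)
    assume P0: "?P \<noteq> 0"
    then have sm: "s < m" using assms(8) by (cases "s = m") auto
    have "inj_on pt {m + 2..<N}"
      using pt_inj_block[OF u_pos] by (rule inj_on_subset) auto
    then have "card {m + 2..<N} = card (pt ` {m + 2..<N})" by (simp add: card_image)
    also have "\<dots> \<le> card {z. poly ?P z = 0}"
      by (intro card_mono) (auto simp: roots)
    also have "\<dots> \<le> degree ?P" by (rule card_poly_roots_bound[OF P0])
    also have "\<dots> \<le> m - s - 1"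
      by (intro degree_sum_le) (auto intro!: order.trans[OF degree_monom_le])
    finally show False using sm assms(9) by simp
  qed
  then have "x $ j = 0" if "j < u * N" for j using x_eq[OF that] by simp
  then have "x = 0\<^sub>v (u * N)" using y(2) by (intro eq_vecI) auto
  then show False using x(2) by simp
qed

lemma vsupp_block_check:
  assumes "k < u" "w k \<noteq> 0"
  shows "vsupp ((checks w e m)\<^sup>T *\<^sub>v unit_vec (u + m) k) = {k * N..<k * N + N}"
proof -
  have "((checks w e m)\<^sup>T *\<^sub>v unit_vec (u + m) k) $ j = (if k = j div N then w k else 0)" if "j < u * N" for j
    using that assms(1) by (simp add: scalar_prod_right_unit) (simp add: checks_def)
  then have "vsupp ((checks w e m)\<^sup>T *\<^sub>v unit_vec (u + m) k) = {j. j < u * N \<and> j div N = k}"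
    using assms(2) by (auto simp: vsupp_def simp del: index_mult_mat_vec split: if_splits)
  also have "\<dots> = {k * N..<k * N + N}"
    using block_subset[OF assms(1)] mem_block by (auto simp: block_div)
  finally show ?thesis .
qed

end

section \<open>Distance, parameters and optimality\<close>

text \<open>The witness x shows that the second branch of \<open>css_distance\<close> applies, and
  it attains d in CX with or without the removed intersection. Some y in CZ is not orthogonal to x;
  it makes the minimum on the CZ side range over a nonempty set.\<close>

lemma css_distance_eqI:
  fixes CX CZ :: "'a::{field,finite} vec set"
  assumes C: "CX \<subseteq> carrier_vec n" "CZ \<subseteq> carrier_vec n"
    and wt: "\<And>x. x \<in> CX \<Longrightarrow> x \<noteq> 0\<^sub>v n \<Longrightarrow> d \<le> card (vsupp x)"
      "\<And>x. x \<in> CZ \<Longrightarrow> x \<noteq> 0\<^sub>v n \<Longrightarrow> d \<le> card (vsupp x)"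
    and x: "x \<in> CX" "x \<notin> dual_code n CZ" "card (vsupp x) \<le> d"
  shows "css_distance n CX CZ = d" "min (min_wt n CX) (min_wt n CZ) = d"
proof -
  have zero: "0\<^sub>v n \<in> dual_code n C" if "C \<subseteq> carrier_vec n" for C :: "'a vec set"
    using that by (auto simp: dual_code_def)
  obtain y where y: "y \<in> CZ" "y \<bullet> x \<noteq> 0" using x C by (auto simp: dual_code_def)
  then have "x \<bullet> y \<noteq> 0" using x(1) C by (metis comm_scalar_prod subsetD)
  then have y': "y \<notin> dual_code n CX" using x by (auto simp: dual_code_def)
  have ne: "x \<noteq> 0\<^sub>v n" "y \<noteq> 0\<^sub>v n" using x(2) y' zero C by blast+
  have fin: "finite CX" "finite CZ" using C by (auto intro: finite_subset)
  have eq: "min_wt n S = d" if "S \<subseteq> CX" "x \<in> S" for S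
    unfolding min_wt_def
  proof (rule Min_eqI)
    show "finite ((\<lambda>x. card (vsupp x)) ` (S - {0\<^sub>v n}))" using finite_subset[OF that(1) fin(1)] by simp
    show "d \<in> (\<lambda>x. card (vsupp x)) ` (S - {0\<^sub>v n})"
      using that ne wt(1)[OF x(1)] x(3) by (intro image_eqI[of _ _ x]) auto
  qed (use that wt(1) in blast)
  have ge: "d \<le> min_wt n S" if "S \<subseteq> CZ" "y \<in> S" for S
    unfolding min_wt_def
  proof (rule Min.boundedI)
    show "finite ((\<lambda>x. card (vsupp x)) ` (S - {0\<^sub>v n}))" using finite_subset[OF that(1) fin(2)] by simp
    show "(\<lambda>x. card (vsupp x)) ` (S - {0\<^sub>v n}) \<noteq> {}" using that ne by blast
  qed (use that wt(2) in blast)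
  show "css_distance n CX CZ = d"
    using eq[of "CX - (CX \<inter> dual_code n CZ)"] ge[of "CZ - (dual_code n CX \<inter> CZ)"] x y(1) y'
    by (auto simp: css_distance_def)
  show "min (min_wt n CX) (min_wt n CZ) = d"
    using eq[of CX] ge[of CZ] x(1) y(1) by simp
qed

context lrc_points
begin

text \<open>Here N plays the role of r + 1 and m that of d - 2.\<close>

lemma exists_pure_eaqlrc:
  fixes v :: "nat \<Rightarrow> 'a"
  assumes pp: "primepow CARD('a)" and v: "\<And>k. v k \<noteq> 0" "(\<Sum>k<u. v k) \<noteq> 0"
    and m: "2 * m + 2 \<le> N" and s: "s \<le> m"
    and inj: "inj_on pt {..<u * N} \<or> m \<le> 2"
  shows "\<exists>(CX :: 'a vec set) (CZ :: 'a vec set) (Q :: 'a state set).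
    css_like_eaqlrc (u * N) (u + s) (N - 1) CX CZ Q \<and>
    locally_recoverable (u * N) (u + s) (N - 1) Q \<and>
    css_parameters (u * N) (int u * int (N - 1) - 2 * int m + int s) (m + 2) (u + s) CX CZ \<and>
    css_pure (u * N) CX CZ"
proof -
  define eX where "eX t = int t + 1" for t
  \<comment> \<open>The first s exponents -1, ..., -s cancel those of \<open>eX\<close>. The others
    are positive, and no further cancellation occurs.\<close>
  define eZ where "eZ t = (if t < s then - (int t + 1) else int (t - s) + 1)" for t
  let ?n = "u * N" and ?k = "u + m" and ?c = "u + s"
  define HX where "HX = checks (\<lambda>_. 1) eX m"
  define HZ where "HZ = checks v eZ m"
  define D where "D = checks_diag v"
  have HX: "HX \<in> carrier_mat ?k ?n" and HZ: "HZ \<in> carrier_mat ?k ?n" by (simp_all add: HX_def HZ_def)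
  have D: "D i \<noteq> 0" for i unfolding D_def by (rule checks_diag_nonzero[OF v])
  have prod: "HX * HZ\<^sup>T = partial_diag ?k ?c D"
  proof -
    have "HX * HZ\<^sup>T = partial_diag ?k ?c (checks_diag (\<lambda>k. 1 * v k))"
      unfolding HX_def HZ_def
      using m s by (intro checks_mult_transpose) (auto simp: eX_def eZ_def)
    then show ?thesis by (simp add: D_def)
  qed
  have prod': "HZ * HX\<^sup>T = partial_diag ?k ?c D"
  proof -
    have "HZ * HX\<^sup>T = (HX * HZ\<^sup>T)\<^sup>T" using HX HZ by (simp add: transpose_mult[of _ ?k ?n])
    then show ?thesis by (simp add: prod partial_diag_transpose)
  qed
  obtain RX where RX: "RX \<in> carrier_mat ?n ?k" "HX * RX = 1\<^sub>m ?k"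
    unfolding HX_def
    \<comment> \<open>The auxiliary matrix carries the weights v, since constant weights alone could
      have sum zero; for HZ the roles are exchanged.\<close>
    by (rule checks_right_inverse[of m eX "\<lambda>_. 1" v]) (use m v in \<open>auto simp: eX_def inj_on_def\<close>)
  obtain RZ where RZ: "RZ \<in> carrier_mat ?n ?k" "HZ * RZ = 1\<^sub>m ?k"
    unfolding HZ_def
    by (rule checks_right_inverse[of m eZ v "\<lambda>_. 1"])
       (use m s v in \<open>auto simp: eZ_def inj_on_def split: if_splits\<close>)
  define CX where "CX = mat_kernel HX"
  define CZ where "CZ = mat_kernel HZ"
  have lin: "linear_code ?n CX" "linear_code ?n CZ"
    unfolding CX_def CZ_def using linear_code_mat_kernel HX HZ by blast+
  have dimX: "code_dim ?n CX + ?k = ?n" unfolding CX_def by (rule code_dim_mat_kernel[OF HX RX])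
  have dimZ: "code_dim ?n CZ + ?k = ?n" unfolding CZ_def by (rule code_dim_mat_kernel[OF HZ RZ])
  have c_le: "?c \<le> ?k" using s by simp
  have hullX: "code_dim ?n (dual_code ?n CX \<inter> CZ) = m - s"
    using code_dim_dual_inter_kernel[OF HX HZ RX prod' c_le D] by (simp add: CX_def CZ_def)
  have hullZ: "code_dim ?n (CX \<inter> dual_code ?n CZ) = m - s"
    using code_dim_dual_inter_kernel[OF HZ HX RZ prod c_le D] by (simp add: CX_def CZ_def Int_commute)
  have dual: "dual_code ?n CX = (*\<^sub>v) HX\<^sup>T ` carrier_vec ?k" "dual_code ?n CZ = (*\<^sub>v) HZ\<^sup>T ` carrier_vec ?k"
    unfolding CX_def CZ_def by (rule dual_code_mat_kernel[OF HX RX] dual_code_mat_kernel[OF HZ RZ])+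
  define FX where "FX = mat ?k ?c (\<lambda>(i, j). if i = j then - D i else 0)"
  define FZ :: "'a mat" where "FZ = inject_coords ?k 0 ?c"
  have F: "FX \<in> carrier_mat ?k ?c" "FZ \<in> carrier_mat ?k ?c" by (simp_all add: FX_def FZ_def)
  have fact: "- (HX * HZ\<^sup>T) = FX * FZ\<^sup>T"
    unfolding prod FX_def FZ_def by (rule partial_diag_rank_factorization[OF c_le])
  define Q where "Q = stabilized_space ?n ?c HX HZ FX FZ"
  have ea: "ea_css_code ?n ?c CX CZ Q"
    unfolding ea_css_code_def
  proof (intro exI conjI)
    show "parity_check_matrix ?n CX HX" "parity_check_matrix ?n CZ HZ"
      using HX HZ dimX dimZ by (auto simp: parity_check_matrix_def CX_def CZ_def)
    show "?c = vec_space.rank (dim_row HX) (HX * HZ\<^sup>T)"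
      using HX rank_partial_diag[OF c_le D] by (simp add: prod)
    show "FX \<in> carrier_mat (dim_row HX) ?c" "FZ \<in> carrier_mat (dim_row HZ) ?c"
      using F HX HZ by auto
    show "- (HX * HZ\<^sup>T) = FX * FZ\<^sup>T" by (rule fact)
    show "Q = stabilized_space ?n ?c HX HZ FX FZ" by (rule Q_def)
  qed
  have cond: "css_support_condition ?n (N - 1) CX CZ"
    unfolding css_support_condition_def dual
  proof (intro allI impI bexI)
    fix i assume "i < ?n"
    then have k: "i div N < u" by (rule div_less_blocks)
    let ?e = "unit_vec ?k (i div N) :: 'a vec"
    have supp: "vsupp (HX\<^sup>T *\<^sub>v ?e) = {i div N * N..<i div N * N + N}"
        "vsupp (HZ\<^sup>T *\<^sub>v ?e) = {i div N * N..<i div N * N + N}"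
      unfolding HX_def HZ_def using k v by (auto intro!: vsupp_block_check)
    show "i \<in> vsupp (HX\<^sup>T *\<^sub>v ?e) \<inter> vsupp (HZ\<^sup>T *\<^sub>v ?e) \<and>
        card (vsupp (HX\<^sup>T *\<^sub>v ?e) \<union> vsupp (HZ\<^sup>T *\<^sub>v ?e)) \<le> N - 1 + 1"
      unfolding supp using mem_block[of i] by simp
  qed auto
  have rec: "locally_recoverable ?n ?c (N - 1) Q"
    unfolding Q_def
    by (rule css_support_condition_imp_locally_recoverable[OF pp HX HZ F fact dual cond])
  obtain x where x: "x \<in> mat_kernel (checks (\<lambda>_. 1) eX m)" "x \<noteq> 0\<^sub>v ?n" "vsupp x \<subseteq> {..<m + 2}"
    by (rule exists_low_weight_kernel_checks[of m "\<lambda>_. 1" eX]) (use m in auto)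
  have x_dual: "x \<notin> dual_code ?n CZ"
    unfolding dual(2) HZ_def
    by (rule low_weight_not_in_row_space[OF x prod[unfolded HX_def HZ_def] D v(1) _ s m]) (auto simp: eZ_def)
  have x_wt: "card (vsupp x) \<le> m + 2" using card_mono[OF _ x(3)] by simp
  have wtX: "m + 2 \<le> card (vsupp z)" if "z \<in> CX" "z \<noteq> 0\<^sub>v ?n" for z
  proof (rule kernel_checks_min_weight[OF that[unfolded CX_def HX_def] _ _ inj])
    fix k assume "k \<le> m"
    then show "0 + int k = 0 \<or> (\<exists>t<m. eX t = 0 + int k)"
      by (cases k) (auto simp: eX_def)
  qed simp
  have wtZ: "m + 2 \<le> card (vsupp z)" if "z \<in> CZ" "z \<noteq> 0\<^sub>v ?n" for z
  proof (rule kernel_checks_min_weight[OF that[unfolded CZ_def HZ_def] v(1) _ inj])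
    fix k assume "k \<le> m"
    \<comment> \<open>The exponents run from -s to m - s, with 0 at k = s. The negative ones are
      stored in descending order, hence the index s - k - 1; the omitted 0 explains the index k - 1
      for the positive ones.\<close>
    consider "k < s" | "k = s" | "k > s" by linarith
    then show "- int s + int k = 0 \<or> (\<exists>t<m. eZ t = - int s + int k)"
    proof cases
      case 1
      then show ?thesis using s by (intro disjI2 exI[of _ "s - k - 1"]) (auto simp: eZ_def)
    next
      case 3
      then show ?thesis using \<open>k \<le> m\<close> by (intro disjI2 exI[of _ "k - 1"]) (auto simp: eZ_def)
    qed simp
  qed
  note dist = css_distance_eqI[OF linear_code_subset[OF lin(1)] linear_code_subset[OF lin(2)] wtX wtZ
      x(1)[folded HX_def CX_def] x_dual x_wt]
  have par: "css_parameters ?n (int u * int (N - 1) - 2 * int m + int s) (m + 2) ?c CX CZ"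
    unfolding css_parameters_def hullX hullZ
  proof (intro conjI)
    have dX: "int (code_dim ?n CX) = int ?n - int ?k" and dZ: "int (code_dim ?n CZ) = int ?n - int ?k"
      using dimX dimZ by linarith+
    show "int ?c = int ?n - int (code_dim ?n CX) - int (m - s)"
      "int ?c = int ?n - int (code_dim ?n CZ) - int (m - s)"
      using s by (simp_all add: dX dZ)
    have "N = Suc (N - 1)" using N_pos by simp
    then have "?n = u * (N - 1) + u" by (metis mult_Suc_right add.commute)
    then have "int ?n = int u * int (N - 1) + int u" by (simp only: of_nat_add of_nat_mult)
    then show "int u * int (N - 1) - 2 * int m + int s = int (code_dim ?n CX) + int (code_dim ?n CZ) - int ?n + int ?c"
      unfolding dX dZ by simp
    show "m + 2 = css_distance ?n CX CZ" by (rule dist(1)[symmetric])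
  qed
  have "css_like_eaqlrc ?n ?c (N - 1) CX CZ Q"
    unfolding css_like_eaqlrc_def using lin ea cond by blast
  moreover have "css_pure ?n CX CZ" unfolding css_pure_def using dist by simp
  ultimately show ?thesis using rec par by blast
qed

end

text \<open>Since \<kappa> = u r - (2m - s) with 0 \<le> 2m - s < r, the ceiling of \<kappa>/r is
  u.\<close>

lemma singleton_optimal_params:
  assumes "r > 0" "2 * m - s < r" "s \<le> m"
  shows "singleton_optimal (u * (r + 1)) (int u * int r - 2 * int m + int s) (m + 2) (u + s) r"
proof -
  let ?\<kappa> = "int u * int r - 2 * int m + int s"
  have "real_of_int ?\<kappa> / real r = real u - real (2 * m - s) / real r"
    using assms by (simp add: field_simps of_nat_diff)
  moreover have "0 \<le> real (2 * m - s) / real r" "real (2 * m - s) / real r < 1"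
    using assms by (simp_all add: field_simps del: of_nat_diff)
  ultimately have "\<lceil>real_of_int ?\<kappa> / real r\<rceil> = int u" by (intro ceiling_unique) auto
  then show ?thesis by (simp add: singleton_optimal_def algebra_simps)
qed

theorem theorem7:
  fixes q d u r s :: nat
  assumes "primepow q" and "CARD('a::{field,finite}) = q"
    and "d > 0" and "u > 0" and "r > 0"
    and "int r > 2 * int d - 4" and "2 * int d - 4 \<ge> 2"
    and "(r + 1) dvd (q - 1)" and "r + 1 < q - 1"
    and "int s \<le> int d - 2"
    and "d \<in> {3, 4} \<or> (d \<ge> 5 \<and> u * (r + 1) \<le> q - 1)"
  shows "\<exists>(CX :: 'a vec set) (CZ :: 'a vec set) (Q :: 'a state set).
           css_like_eaqlrc (u * (r + 1)) (u + s) r CX CZ Q \<and>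
           locally_recoverable (u * (r + 1)) (u + s) r Q \<and>
           css_parameters (u * (r + 1)) (int u * int r - 2 * int d + 4 + int s) d (u + s) CX CZ \<and>
           css_pure (u * (r + 1)) CX CZ \<and>
           singleton_optimal (u * (r + 1)) (int u * int r - 2 * int d + 4 + int s) d (u + s) r"
proof -
  define N where "N = r + 1"
  define m where "m = d - 2"
  \<comment> \<open>The subtraction in m is exact because 2d - 4 \<ge> 2 forces d \<ge> 3; and r >
    2d - 4 = 2m gives N \<ge> 2m + 2.\<close>
  have d: "d = m + 2" and s: "s \<le> m" and mN: "2 * m + 2 \<le> N"
    using assms(6,7,10) by (simp_all add: m_def N_def)
  have N: "N > 0" "N dvd CARD('a) - 1" using assms(2,8) by (simp_all add: N_def)
  have pp: "primepow CARD('a)" using assms(1,2) by simp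
  let ?U = "{x::'a. x ^ N = 1}"
  have cardU: "card ?U = N" by (rule card_roots_of_unity[OF N(2,1)])
  then obtain \<omega> where \<omega>: "bij_betw \<omega> {..<N} ?U"
    using ex_bij_betw_nat_finite[of ?U] by (auto simp: atLeast0LessThan)
  have \<omega>U: "\<omega> l ^ N = 1" if "l < N" for l using \<omega> that by (auto simp: bij_betw_def)
  obtain \<beta> :: "nat \<Rightarrow> 'a" where \<beta>: "\<And>k. \<beta> k \<noteq> 0" "inj_on (\<lambda>k. \<beta> k ^ N) {..<u} \<or> m \<le> 2"
  proof (cases "d \<ge> 5")
    case True
    then have "u * N \<le> CARD('a) - 1" using assms(2,11) by (auto simp: N_def)
    then show ?thesis using distinct_coset_representatives[OF N(2,1)] that by metis
  next
    case False
    then show ?thesis using that[of "\<lambda>_. 1"] d by simp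
  qed
  define pt where "pt j = \<beta> (j div N) * \<omega> (j mod N)" for j
  have \<omega>0: "\<omega> l \<noteq> 0" if "l < N" for l using \<omega>U[OF that] N(1) by (auto simp: power_0_left)
  have pt_block: "pt j = \<beta> k * \<omega> (j - k * N)" if "j \<in> {k * N..<k * N + N}" for j k
  proof -
    have "j div N = k" using that by (auto intro!: div_nat_eqI simp: mult.commute)
    then show ?thesis by (simp add: pt_def modulo_nat_def mult.commute)
  qed
  interpret lrc_points N u pt
  proof
    show "of_nat N \<noteq> (0::'a)"
    proof
      \<comment> \<open>The characteristic divides q; if it divided N, it would also divide q - 1
        and hence 1.\<close>
      assume "of_nat N = (0::'a)"
      then have "CHAR('a) dvd CARD('a) - 1" using N(2) by (meson dvd_trans of_nat_eq_0_iff_char_dvd)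
      then have "CHAR('a) dvd CARD('a) - (CARD('a) - 1)" by (rule dvd_diff_nat[OF CHAR_dvd_CARD])
      also have "CARD('a) - (CARD('a) - 1) = 1" using zero_less_card_finite[where ?'a = 'a] by simp
      finally have "CHAR('a) dvd 1" .
      then show False using prime_CHAR_finite_field[where ?'a = 'a] by (auto dest: prime_gt_1_nat)
    qed
    show "pt j \<noteq> 0" for j using \<beta>(1) \<omega>0 N(1) by (simp add: pt_def)
    fix k :: nat
    show "inj_on pt {k * N..<k * N + N}"
    proof (rule inj_onI)
      fix i j assume ij: "i \<in> {k * N..<k * N + N}" "j \<in> {k * N..<k * N + N}" "pt i = pt j"
      then have "\<omega> (i - k * N) = \<omega> (j - k * N)" using \<beta>(1) by (simp add: pt_block)
      then have "i - k * N = j - k * N" using \<omega> ij by (auto simp: bij_betw_def inj_on_def)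
      then show "i = j" using ij by auto
    qed
    fix e :: int assume e: "\<bar>e\<bar> < int N"
    have "(\<Sum>j\<in>{k * N..<k * N + N}. pt j powi e) = (\<Sum>l<N. \<beta> k powi e * \<omega> l powi e)"
      by (rule sum.reindex_bij_witness[of _ "\<lambda>l. k * N + l" "\<lambda>j. j - k * N"])
         (auto simp: pt_block power_int_mult_distrib)
    also have "\<dots> = \<beta> k powi e * (\<Sum>x\<in>?U. x powi e)"
      by (simp only: sum_distrib_left[symmetric] sum.reindex_bij_betw[OF \<omega>, of "\<lambda>x. x powi e"])
    also have "\<dots> = (if e = 0 then of_nat N else 0)"
      by (simp add: sum_roots_of_unity_powi[OF N(2) e])
    finally show "(\<Sum>j\<in>{k * N..<k * N + N}. pt j powi e) = (if e = 0 then of_nat N else 0)" .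
  qed (use N(1) assms(4) in auto)
  have inj: "inj_on pt {..<u * N} \<or> m \<le> 2"
    using \<beta>(2)
  proof
    assume inj\<beta>: "inj_on (\<lambda>k. \<beta> k ^ N) {..<u}"
    have "inj_on pt {..<u * N}"
    proof (rule inj_onI)
      fix i j assume ij: "i \<in> {..<u * N}" "j \<in> {..<u * N}" "pt i = pt j"
      \<comment> \<open>The N-th power of a point depends only on its block, so equal points lie in
        the same block, where they are already known to be distinct.\<close>
      have "pt l ^ N = \<beta> (l div N) ^ N" for l
        using \<omega>U[of "l mod N"] N(1) by (simp add: pt_def power_mult_distrib)
      then have "\<beta> (i div N) ^ N = \<beta> (j div N) ^ N" using ij(3) by metis
      then have "i div N = j div N" using inj\<beta> ij div_less_blocks by (auto dest: inj_onD)
      then show "i = j"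
        using pt_inj_block[of "j div N"] mem_block[of i] mem_block[of j] ij div_less_blocks[of j]
        by (auto dest: inj_onD)
    qed
    then show ?thesis ..
  qed simp
  obtain v :: "nat \<Rightarrow> 'a" where v: "\<And>k. v k \<noteq> 0" "(\<Sum>k<u. v k) \<noteq> 0"
    by (rule nonzero_weights_with_nonzero_sum[of u, where ?'a = 'a]) (use assms(2,4,5,9) in auto)
  have \<kappa>: "int u * int r - 2 * int d + 4 + int s = int u * int r - 2 * int m + int s"
    by (simp add: d)
  have opt: "singleton_optimal (u * (r + 1)) (int u * int r - 2 * int m + int s) d (u + s) r"
    unfolding d by (rule singleton_optimal_params) (use assms(5) mN s in \<open>auto simp: N_def\<close>)
  show ?thesis
    using exists_pure_eaqlrc[OF pp v mN s inj] opt unfolding \<kappa> by (auto simp: N_def d)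
qed

end
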